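(* Let $M_t$ be a family of smooth closed strictly convex surfaces in $\mathbb{R}^3$ moving according to $\frac{d}{dt}X=\frac{H^2}{K^2}\nu$. Then $$\max_{M_t}\frac{(\lambda_1-\lambda_2)^2}{2(\lambda_1+\lambda_2)\lambda_1\lambda_2}$$ is non-increasing in time.
   Context: $X$ denotes the embedding, $\nu$ the outer unit normal, $\lambda_1,\lambda_2>0$ the principal curvatures, $H=\lambda_1+\lambda_2$, $K=\lambda_1\lambda_2$. *)

theory Defs
  imports "HOL-Analysis.Analysis"
begin

text \<open>Parameter domain: the unit sphere S2 in R^3. A closed strictly convex surface
  is parametrised by an embedding of S2; a flow is a smooth map X p t.\<close>

definition S2 :: "(real^3) set" where
  "S2 = sphere 0 1"

fun Ck_on :: "nat \<Rightarrow> 'a set \<Rightarrow> ('a::real_normed_vector \<Rightarrow> 'b::real_normed_vector) \<Rightarrow> bool" where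
  "Ck_on 0 U f = continuous_on U f"
| "Ck_on (Suc k) U f = (f differentiable_on U \<and>
      (\<forall>v. Ck_on k U (\<lambda>x. frechet_derivative f (at x) v)))"

definition smooth_on :: "'a set \<Rightarrow> ('a::real_normed_vector \<Rightarrow> 'b::real_normed_vector) \<Rightarrow> bool" where
  "smooth_on U f = (\<forall>k. Ck_on k U f)"

text \<open>The surface M_t and the differential of the embedding (on tangent vectors v, v \<bullet> p = 0).\<close>
definition surf :: "(real^3 \<Rightarrow> real \<Rightarrow> real^3) \<Rightarrow> real \<Rightarrow> (real^3) set" where
  "surf X t = (\<lambda>q. X q t) ` S2"

definition dX :: "(real^3 \<Rightarrow> real \<Rightarrow> real^3) \<Rightarrow> real \<Rightarrow> real^3 \<Rightarrow> real^3 \<Rightarrow> real^3" where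
  "dX X t p = frechet_derivative (\<lambda>q. X q t) (at p within S2)"

definition embedded_surface :: "(real^3 \<Rightarrow> real \<Rightarrow> real^3) \<Rightarrow> real \<Rightarrow> bool" where
  "embedded_surface X t \<longleftrightarrow> inj_on (\<lambda>q. X q t) S2 \<and>
     (\<forall>p\<in>S2. \<forall>v. v \<bullet> p = 0 \<and> v \<noteq> 0 \<longrightarrow> dX X t p v \<noteq> 0)"

definition outer_normal :: "(real^3 \<Rightarrow> real \<Rightarrow> real^3) \<Rightarrow> real \<Rightarrow> real^3 \<Rightarrow> real^3" where
  "outer_normal X t p = (SOME n. norm n = 1 \<and> (\<forall>v. v \<bullet> p = 0 \<longrightarrow> n \<bullet> dX X t p v = 0) \<and>
      (\<forall>\<^sub>F s in at_right 0. X p t + s *\<^sub>R n \<in> outside (surf X t)))"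

definition principal_curvatures :: "(real^3 \<Rightarrow> real \<Rightarrow> real^3) \<Rightarrow> real \<Rightarrow> real^3 \<Rightarrow> real set" where
  "principal_curvatures X t p = {lam. \<exists>v. v \<bullet> p = 0 \<and> v \<noteq> 0 \<and>
      frechet_derivative (\<lambda>q. outer_normal X t q) (at p within S2) v = lam *\<^sub>R dX X t p v}"

definition kappa1 :: "(real^3 \<Rightarrow> real \<Rightarrow> real^3) \<Rightarrow> real \<Rightarrow> real^3 \<Rightarrow> real" where
  "kappa1 X t p = Max (principal_curvatures X t p)"

definition kappa2 :: "(real^3 \<Rightarrow> real \<Rightarrow> real^3) \<Rightarrow> real \<Rightarrow> real^3 \<Rightarrow> real" where
  "kappa2 X t p = Min (principal_curvatures X t p)"

definition mean_curv :: "(real^3 \<Rightarrow> real \<Rightarrow> real^3) \<Rightarrow> real \<Rightarrow> real^3 \<Rightarrow> real" where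
  "mean_curv X t p = kappa1 X t p + kappa2 X t p"

definition gauss_curv :: "(real^3 \<Rightarrow> real \<Rightarrow> real^3) \<Rightarrow> real \<Rightarrow> real^3 \<Rightarrow> real" where
  "gauss_curv X t p = kappa1 X t p * kappa2 X t p"

definition strictly_convex :: "(real^3 \<Rightarrow> real \<Rightarrow> real^3) \<Rightarrow> real \<Rightarrow> bool" where
  "strictly_convex X t \<longleftrightarrow> (\<forall>p\<in>S2. kappa1 X t p > 0 \<and> kappa2 X t p > 0)"

end

theory Submission
  imports Defs
begin

text \<open>In terms of the principal radii \<open>r\<^sub>i = 1 / \<lambda>\<^sub>i\<close> the flow reads \<open>h\<^sub>t = (r\<^sub>1 + r\<^sub>2)\<^sup>2\<close> for the support
  function \<open>h\<close> of \<open>M\<^sub>t\<close> as a function of the normal, and the quantity to be bounded is \<open>Q / s\<close> with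
  \<open>s = r\<^sub>1 + r\<^sub>2\<close> and \<open>Q = (r\<^sub>1 - r\<^sub>2)\<^sup>2 / 2\<close>. With \<open>h\<close> extended to be homogeneous of degree 1, \<open>s\<close> is the trace
  of its Euclidean Hessian \<open>B\<close> and \<open>Q = |B|\<^sup>2 - s\<^sup>2 / 2\<close>, so no curvature terms arise from commuting
  derivatives. At a spatial maximum \<open>M\<close> of \<open>Q / s\<close> one finds \<open>\<partial>\<^sub>t (Q - M s) \<le> - 10 s Q\<close> plus gradient terms
  that form a negative sum of squares, and the maximum principle applies.

  Instead of inverting the Gauss map \<open>\<nu>\<close> we keep the original parameters and differentiate along the
  vector fields that \<open>\<nu>\<close> maps to constant ones. The Gauss map is smooth because the velocity is a positive
  multiple of \<open>\<nu>\<close>.\<close>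

section \<open>Smooth functions on open sets\<close>

text \<open>Three features of the definitions shape the proof. \<open>outer_normal\<close> is a
  choice, so nothing is known about it, not even that it is a unit normal, until a vector with the
  required properties exists; that there is one rests on the Jordan-Brouwer theorem. The principal
  curvatures are \<open>Max\<close> and \<open>Min\<close> of a set, with no evident regularity and
  meaningful only if the set is finite; so the estimates are expressed by trace and norm of the
  Hessian, which are smooth. And derivatives within \<open>S2\<close> are determined on tangent
  vectors only; so the parameter too is extended off the sphere, \<open>X\<close> with degree 0 and
  the normal with degree 1. This makes the derivative of the extended normal map an invertible 3x3
  matrix: radially by homogeneity, tangentially because no principal curvature vanishes.

  In the maximum argument M is frozen: \<open>Q - M s\<close> is nonpositive at the time in question
  and vanishes at the maximum point, so no quotient is differentiated. The estimate is not strict,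
  hence the maximum principle is applied to the quotient minus \<open>eps * t\<close>, and then eps
  tends to 0.\<close>

definition dd :: "'a \<Rightarrow> ('a::real_normed_vector \<Rightarrow> 'b::real_normed_vector) \<Rightarrow> 'a \<Rightarrow> 'b" where
  "dd v f x = frechet_derivative f (at x) v"

lemma dd_eqI: "(f has_derivative f') (at x) \<Longrightarrow> dd v f x = f' v"
  by (simp add: dd_def frechet_derivative_at[symmetric])

lemma has_derivative_dd: "f differentiable (at x) \<Longrightarrow> (f has_derivative (\<lambda>v. dd v f x)) (at x)"
  unfolding dd_def using frechet_derivative_works[of f "at x"] by simp

lemma differentiable_transform_open:
  assumes "f differentiable (at x)" "open U" "x \<in> U" "\<And>y. y \<in> U \<Longrightarrow> f y = g y"
  shows "g differentiable (at x)"
  using assms has_derivative_transform_within_open[of f _ x UNIV U g] unfolding differentiable_def by blast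

text \<open>Both functions have the same candidate derivatives at \<open>x\<close>, so the choice
  made by \<open>frechet_derivative\<close> is the same for both, even if there is no
  candidate.\<close>

lemma dd_cong_open:
  assumes "open U" "x \<in> U" "\<And>y. y \<in> U \<Longrightarrow> f y = g y"
  shows "dd v f x = dd v g x"
proof -
  have "(f has_derivative f') (at x) \<longleftrightarrow> (g has_derivative f') (at x)" for f'
    using has_derivative_transform_within_open[OF _ assms(1,2), of f f' UNIV g]
      has_derivative_transform_within_open[OF _ assms(1,2), of g f' UNIV f] assms(3) by auto
  then show ?thesis by (simp add: dd_def frechet_derivative_def)
qed

lemma Ck_on_Suc:
  assumes "open U"
  shows "Ck_on (Suc k) U f \<longleftrightarrow> (\<forall>x\<in>U. f differentiable (at x)) \<and> (\<forall>v. Ck_on k U (dd v f))"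
proof -
  have "f differentiable_on U \<longleftrightarrow> (\<forall>x\<in>U. f differentiable (at x))"
    unfolding differentiable_on_def using at_within_open[OF _ assms] by auto
  moreover have "dd v f = (\<lambda>x. frechet_derivative f (at x) v)" for v
    by (rule ext) (rule dd_def)
  ultimately show ?thesis unfolding Ck_on.simps by simp
qed

lemma Ck_on_cong:
  assumes "open U" "\<And>x. x \<in> U \<Longrightarrow> f x = g x" "Ck_on k U f"
  shows "Ck_on k U g"
  using assms(2,3)
proof (induction k arbitrary: f g)
  case 0
  then show ?case by (simp cong: continuous_on_cong)
next
  case (Suc k)
  have "dd v f x = dd v g x" if "x \<in> U" for v x
    using dd_cong_open[OF assms(1) that, of f g] Suc.prems by blast
  moreover have "g differentiable (at x)" if "x \<in> U" for x
    using differentiable_transform_open[OF _ assms(1) that, of f g] Suc.prems that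
    by (simp only: Ck_on_Suc[OF assms(1)])
  ultimately show ?case
    using Suc.IH Suc.prems Ck_on_Suc[OF assms(1), of k f] Ck_on_Suc[OF assms(1), of k g] by metis
qed

lemma Ck_on_SucD:
  assumes "open U" "Ck_on (Suc k) U f"
  shows "Ck_on k U f"
  using assms(2)
proof (induction k arbitrary: f)
  case 0
  then have "\<forall>x\<in>U. f differentiable (at x)" unfolding Ck_on_Suc[OF assms(1)] by blast
  then show ?case
    by (simp add: continuous_at_imp_continuous_on differentiable_imp_continuous_within)
next
  case (Suc k)
  show ?case
    using Suc.prems Suc.IH Ck_on_Suc[OF assms(1), of k f] Ck_on_Suc[OF assms(1), of "Suc k" f] by blast
qed

lemma Ck_on_const: "open U \<Longrightarrow> Ck_on k U (\<lambda>x. c)"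
proof (induction k arbitrary: c)
  case (Suc k)
  have "dd v (\<lambda>x::'a. c) = (\<lambda>x. 0)" for v
    by (rule ext, rule dd_eqI) (rule has_derivative_const)
  then show ?case using Suc by (simp add: Ck_on_Suc del: Ck_on.simps)
qed simp

lemma Ck_on_bounded_linear:
  assumes "open U" "bounded_linear f"
  shows "Ck_on k U f"
proof (cases k)
  case 0
  then show ?thesis using assms by (simp add: linear_continuous_on)
next
  case (Suc m)
  have "dd v f = (\<lambda>x. f v)" for v
    by (rule ext, rule dd_eqI) (use assms(2) bounded_linear_imp_has_derivative in blast)
  moreover have "f differentiable (at x)" for x
    using assms(2) bounded_linear_imp_differentiable by blast
  ultimately show ?thesis unfolding Suc Ck_on_Suc[OF assms(1)] by (simp add: Ck_on_const[OF assms(1)])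
qed

lemma Ck_on_add:
  assumes "open U" "Ck_on k U f" "Ck_on k U g"
  shows "Ck_on k U (\<lambda>x. f x + g x)"
  using assms(2,3)
proof (induction k arbitrary: f g)
  case 0
  then show ?case by (simp add: continuous_on_add)
next
  case (Suc k)
  have f: "\<forall>x\<in>U. f differentiable (at x)" "\<And>v. Ck_on k U (dd v f)"
   and g: "\<forall>x\<in>U. g differentiable (at x)" "\<And>v. Ck_on k U (dd v g)"
    using Suc.prems Ck_on_Suc[OF assms(1)] by blast+
  have d: "dd v (\<lambda>x. f x + g x) x = dd v f x + dd v g x" if "x \<in> U" for v x
    by (rule dd_eqI, rule has_derivative_add) (use f g that has_derivative_dd in blast)+
  have "Ck_on k U (dd v (\<lambda>x. f x + g x))" for v
    by (rule Ck_on_cong[OF assms(1) d[symmetric] Suc.IH[OF f(2)[of v] g(2)[of v]]])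
  then show ?case unfolding Ck_on_Suc[OF assms(1)] using f g by auto
qed

lemma Ck_on_bilinear:
  assumes "open U" "bounded_bilinear B" "Ck_on k U f" "Ck_on k U g"
  shows "Ck_on k U (\<lambda>x. B (f x) (g x))"
  using assms(3,4)
proof (induction k arbitrary: f g)
  case 0
  then show ?case using bounded_bilinear.continuous_on[OF assms(2)] by auto
next
  case (Suc k)
  have f: "\<forall>x\<in>U. f differentiable (at x)" "\<And>v. Ck_on k U (dd v f)"
   and g: "\<forall>x\<in>U. g differentiable (at x)" "\<And>v. Ck_on k U (dd v g)"
    using Suc.prems Ck_on_Suc[OF assms(1)] by blast+
  have fk: "Ck_on k U f" "Ck_on k U g" using Suc.prems Ck_on_SucD[OF assms(1)] by blast+
  have D: "((\<lambda>x. B (f x) (g x)) has_derivative (\<lambda>v. B (f x) (dd v g x) + B (dd v f x) (g x))) (at x)"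
    if "x \<in> U" for x
    by (rule bounded_bilinear.FDERIV[OF assms(2)]) (use f g that has_derivative_dd in blast)+
  have d: "dd v (\<lambda>x. B (f x) (g x)) x = B (f x) (dd v g x) + B (dd v f x) (g x)" if "x \<in> U" for v x
    using D[OF that] by (rule dd_eqI)
  have "Ck_on k U (dd v (\<lambda>x. B (f x) (g x)))" for v
    by (rule Ck_on_cong[OF assms(1) d[symmetric]], assumption)
       (intro Ck_on_add assms(1) Suc.IH fk f(2) g(2))
  then show ?case unfolding Ck_on_Suc[OF assms(1)] using D differentiable_def by blast
qed

lemma Ck_on_sum:
  assumes "open U" "\<And>i. i \<in> I \<Longrightarrow> Ck_on k U (f i)"
  shows "Ck_on k U (\<lambda>x. \<Sum>i\<in>I. f i x)"
  using assms(2)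
proof (induction I rule: infinite_finite_induct)
  case (insert i I)
  then show ?case by (simp add: Ck_on_add[OF assms(1)])
qed (auto intro: Ck_on_const[OF assms(1)])

text \<open>The chain rule yields a derivative of \<open>f\<close> in a direction that varies with
  the point, to which an induction over fixed directions does not apply. Expanding that direction in
  the basis of the middle space leaves derivatives \<open>dd i f\<close> in fixed directions, with
  coefficients of class \<open>Ck_on k\<close>.\<close>

lemma Ck_on_compose:
  fixes g :: "'a::real_normed_vector \<Rightarrow> 'b::euclidean_space"
  assumes "open U" "open W" "g ` U \<subseteq> W" "Ck_on k W f" "Ck_on k U g"
  shows "Ck_on k U (\<lambda>x. f (g x))"
  using assms(4,5)
proof (induction k arbitrary: f)
  case 0
  then show ?case using assms(3) continuous_on_compose2[of W f U g] by auto
next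
  case (Suc k)
  have f: "\<And>x. x\<in>W \<Longrightarrow> f differentiable (at x)" "\<And>v. Ck_on k W (dd v f)"
    using Suc.prems unfolding Ck_on_Suc[OF assms(2)] by blast+
  have g: "\<And>x. x\<in>U \<Longrightarrow> g differentiable (at x)" "\<And>v. Ck_on k U (dd v g)"
    using Suc.prems Ck_on_Suc[OF assms(1)] by blast+
  have gk: "Ck_on k U g" using Suc.prems Ck_on_SucD[OF assms(1)] by blast
  have D: "((\<lambda>x. f (g x)) has_derivative (\<lambda>v. dd (dd v g x) f (g x))) (at x)" if "x \<in> U" for x
    by (rule has_derivative_compose[of g, OF has_derivative_dd has_derivative_dd])
       (use f g assms(3) that in auto)
  have d: "dd v (\<lambda>x. f (g x)) x = (\<Sum>i\<in>Basis. (dd v g x \<bullet> i) *\<^sub>R dd i f (g x))" if "x \<in> U" for v x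
  proof -
    have "linear (\<lambda>w. dd w f (g x))"
      using has_derivative_dd[OF f(1), of "g x"] assms(3) that has_derivative_linear by blast
    then have "dd (dd v g x) f (g x) = (\<Sum>i\<in>Basis. (dd v g x \<bullet> i) *\<^sub>R dd i f (g x))"
      using linear_sum[of "\<lambda>w. dd w f (g x)" "\<lambda>i. (dd v g x \<bullet> i) *\<^sub>R i" Basis]
      by (simp add: euclidean_representation linear_cmul[of "\<lambda>w. dd w f (g x)"])
    then show ?thesis using dd_eqI[OF D[OF that]] by simp
  qed
  have "Ck_on k U (dd v (\<lambda>x. f (g x)))" for v
    by (rule Ck_on_cong[OF assms(1) d[symmetric]], assumption)
       (intro Ck_on_sum assms(1) Ck_on_bilinear[OF assms(1) bounded_bilinear_scaleR]
          Suc.IH[OF f(2) gk] Ck_on_bilinear[OF assms(1) bounded_bilinear_inner g(2)] Ck_on_const)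
  then show ?case unfolding Ck_on_Suc[OF assms(1)] using D differentiable_def by blast
qed

text \<open>The exponent is general because differentiation lowers it by 1; the exponents 1/2 and -1
  then give norms and reciprocals.\<close>

lemma Ck_on_powr:
  fixes f :: "'a::real_normed_vector \<Rightarrow> real"
  assumes "open U" "\<And>x. x \<in> U \<Longrightarrow> f x > 0" "Ck_on k U f"
  shows "Ck_on k U (\<lambda>x. f x powr a)"
  using assms(3)
proof (induction k arbitrary: a)
  case 0
  have "\<forall>x\<in>U. f x \<noteq> 0" using assms(2) by force
  then show ?case using 0 continuous_on_powr[of U f "\<lambda>x. a"] by simp
next
  case (Suc k)
  have f: "\<And>x. x\<in>U \<Longrightarrow> f differentiable (at x)" "\<And>v. Ck_on k U (dd v f)"
    using Suc.prems Ck_on_Suc[OF assms(1)] by blast+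
  have fk: "Ck_on k U f" using Suc.prems Ck_on_SucD[OF assms(1)] by blast
  have D: "((\<lambda>x. f x powr a) has_derivative (\<lambda>v. a * (f x powr (a - 1) * dd v f x))) (at x)" if "x \<in> U" for x
    using has_derivative_powr[OF has_derivative_dd[OF f(1)[OF that]] has_derivative_const[of a]]
      assms(2)[OF that] by (simp add: powr_diff field_simps)
  have d: "dd v (\<lambda>x. f x powr a) x = a * (f x powr (a - 1) * dd v f x)" if "x \<in> U" for v x
    using D[OF that] by (rule dd_eqI)
  have "Ck_on k U (dd v (\<lambda>x. f x powr a))" for v
    by (rule Ck_on_cong[OF assms(1) d[symmetric]], assumption)
       (intro Ck_on_bilinear[OF assms(1) bounded_bilinear_mult] Suc.IH[OF fk] f(2) Ck_on_const assms(1))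
  then show ?case unfolding Ck_on_Suc[OF assms(1)] using D differentiable_def by blast
qed

section \<open>Closure properties of smooth functions\<close>

lemma smooth_on_cong:
  "open U \<Longrightarrow> smooth_on U f \<Longrightarrow> (\<And>x. x \<in> U \<Longrightarrow> f x = g x) \<Longrightarrow> smooth_on U g"
  unfolding smooth_on_def using Ck_on_cong by blast

lemma smooth_on_dd: "open U \<Longrightarrow> smooth_on U f \<Longrightarrow> smooth_on U (dd v f)"
  unfolding smooth_on_def using Ck_on_Suc by blast

lemma smooth_on_differentiable: "open U \<Longrightarrow> smooth_on U f \<Longrightarrow> x \<in> U \<Longrightarrow> f differentiable (at x)"
  unfolding smooth_on_def using Ck_on_Suc[of U 0 f] by blast

lemma smooth_on_has_derivative:
  "open U \<Longrightarrow> smooth_on U f \<Longrightarrow> x \<in> U \<Longrightarrow> (f has_derivative (\<lambda>v. dd v f x)) (at x)"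
  by (simp add: smooth_on_differentiable has_derivative_dd)

lemma smooth_on_continuous: "smooth_on U f \<Longrightarrow> continuous_on U f"
  unfolding smooth_on_def by (metis Ck_on.simps(1))

lemma smooth_on_const: "open U \<Longrightarrow> smooth_on U (\<lambda>x. c)"
  unfolding smooth_on_def using Ck_on_const by blast

lemma smooth_on_bounded_linear: "open U \<Longrightarrow> bounded_linear f \<Longrightarrow> smooth_on U f"
  unfolding smooth_on_def using Ck_on_bounded_linear by blast

lemma smooth_on_add: "open U \<Longrightarrow> smooth_on U f \<Longrightarrow> smooth_on U g \<Longrightarrow> smooth_on U (\<lambda>x. f x + g x)"
  unfolding smooth_on_def using Ck_on_add by blast

lemma smooth_on_bilinear:
  "open U \<Longrightarrow> bounded_bilinear B \<Longrightarrow> smooth_on U f \<Longrightarrow> smooth_on U g \<Longrightarrow> smooth_on U (\<lambda>x. B (f x) (g x))"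
  unfolding smooth_on_def using Ck_on_bilinear by blast

lemmas smooth_on_scaleR = smooth_on_bilinear[OF _ bounded_bilinear_scaleR]
lemmas smooth_on_mult = smooth_on_bilinear[OF _ bounded_bilinear_mult]
lemmas smooth_on_inner = smooth_on_bilinear[OF _ bounded_bilinear_inner]

lemma smooth_on_uminus: "open U \<Longrightarrow> smooth_on U f \<Longrightarrow> smooth_on U (\<lambda>x. - f x)"
  using smooth_on_scaleR[OF _ smooth_on_const[of U "-1"], of f] by simp

lemma smooth_on_diff: "open U \<Longrightarrow> smooth_on U f \<Longrightarrow> smooth_on U g \<Longrightarrow> smooth_on U (\<lambda>x. f x - g x)"
  using smooth_on_add[OF _ _ smooth_on_uminus, of U f g] by simp

lemma smooth_on_sum: "open U \<Longrightarrow> (\<And>i. i \<in> I \<Longrightarrow> smooth_on U (f i)) \<Longrightarrow> smooth_on U (\<lambda>x. \<Sum>i\<in>I. f i x)"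
  by (auto simp: smooth_on_def intro!: Ck_on_sum)

lemma smooth_on_compose:
  fixes g :: "'a::real_normed_vector \<Rightarrow> 'b::euclidean_space"
  shows "open U \<Longrightarrow> open W \<Longrightarrow> g ` U \<subseteq> W \<Longrightarrow> smooth_on W f \<Longrightarrow> smooth_on U g \<Longrightarrow> smooth_on U (\<lambda>x. f (g x))"
  unfolding smooth_on_def by (rule allI, rule Ck_on_compose[of U W]) simp_all

lemma smooth_on_Pair:
  fixes f :: "'a::real_normed_vector \<Rightarrow> 'b::euclidean_space" and g :: "'a \<Rightarrow> 'c::euclidean_space"
  assumes "open W" "smooth_on W f" "smooth_on W g"
  shows "smooth_on W (\<lambda>z. (f z, g z))"
proof -
  have "smooth_on W (\<lambda>z. (\<lambda>x. (x, 0)) (f z) + (\<lambda>x. (0, x)) (g z))"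
    by (intro smooth_on_add assms(1) smooth_on_compose[OF assms(1) open_UNIV _ _ assms(2)]
        smooth_on_compose[OF assms(1) open_UNIV _ _ assms(3)] smooth_on_bounded_linear open_UNIV)
      (auto intro!: bounded_linear_intros)
  then show ?thesis by simp
qed

lemma smooth_on_powr:
  fixes f :: "'a::real_normed_vector \<Rightarrow> real"
  shows "open U \<Longrightarrow> (\<And>x. x \<in> U \<Longrightarrow> f x > 0) \<Longrightarrow> smooth_on U f \<Longrightarrow> smooth_on U (\<lambda>x. f x powr a)"
  by (simp add: smooth_on_def Ck_on_powr)

lemma smooth_on_norm:
  fixes f :: "'a::real_normed_vector \<Rightarrow> 'b::real_inner"
  assumes "open U" "\<And>x. x \<in> U \<Longrightarrow> f x \<noteq> 0" "smooth_on U f"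
  shows "smooth_on U (\<lambda>x. norm (f x))"
proof -
  have "smooth_on U (\<lambda>x. (f x \<bullet> f x) powr (1/2))"
    using assms by (intro smooth_on_powr smooth_on_inner) auto
  then show ?thesis by (simp add: powr_half_sqrt norm_eq_sqrt_inner)
qed

lemma smooth_on_inverse:
  fixes f :: "'a::real_normed_vector \<Rightarrow> real"
  assumes "open U" "\<And>x. x \<in> U \<Longrightarrow> f x \<noteq> 0" "smooth_on U f"
  shows "smooth_on U (\<lambda>x. inverse (f x))"
proof -
  have "0 < f x * f x" if "x \<in> U" for x
    using assms(2)[OF that] not_real_square_gt_zero by blast
  \<comment> \<open>\<open>powr\<close> wants a positive base, so the reciprocal is written as
    \<open>f x\<close> divided by its square.\<close>
  then have "smooth_on U (\<lambda>x. f x * ((f x * f x) powr (-1)))"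
    using assms by (intro smooth_on_powr smooth_on_mult) auto
  then show ?thesis
    by (rule smooth_on_cong[OF assms(1)])
       (use assms(2) in \<open>auto simp: powr_minus_divide field_simps\<close>)
qed

lemma bounded_bilinear_cross3: "bounded_bilinear cross3"
  using bilinear_cross bilinear_conv_bounded_bilinear by blast

lemmas smooth_on_cross3 = smooth_on_bilinear[OF _ bounded_bilinear_cross3]

lemma dd_add:
  assumes "open U" "smooth_on U f" "smooth_on U g" "x \<in> U"
  shows "dd v (\<lambda>x. f x + g x) x = dd v f x + dd v g x"
  by (rule dd_eqI, rule has_derivative_add) (use assms smooth_on_has_derivative in blast)+

lemma dd_bilinear:
  assumes "open U" "bounded_bilinear B" "smooth_on U f" "smooth_on U g" "x \<in> U"
  shows "dd v (\<lambda>x. B (f x) (g x)) x = B (f x) (dd v g x) + B (dd v f x) (g x)"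
  by (rule dd_eqI, rule bounded_bilinear.FDERIV[OF assms(2)])
     (use assms smooth_on_has_derivative in blast)+

lemma dd_const: "dd v (\<lambda>x. c) x = 0"
  by (rule dd_eqI) (rule has_derivative_const)

lemma dd_linear:
  assumes "open U" "smooth_on U f" "x \<in> U"
  shows "linear (\<lambda>v. dd v f x)"
  using smooth_on_has_derivative[OF assms] has_derivative_linear by blast

section \<open>Mean value theorem, symmetry of second derivatives, second derivative test\<close>

lemma dd_mvt:
  fixes f :: "'a::real_normed_vector \<Rightarrow> real"
  assumes "s > 0" "\<And>r. 0 \<le> r \<Longrightarrow> r \<le> s \<Longrightarrow> f differentiable (at (x + r *\<^sub>R v))"
  shows "\<exists>r. 0 < r \<and> r < s \<and> f (x + s *\<^sub>R v) - f x = s * dd v f (x + r *\<^sub>R v)"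
proof -
  have D: "((\<lambda>r. f (x + r *\<^sub>R v)) has_real_derivative dd v f (x + r *\<^sub>R v)) (at r)"
    if "0 \<le> r" "r \<le> s" for r
  proof -
    have "((\<lambda>r. x + r *\<^sub>R v) has_derivative (\<lambda>h. h *\<^sub>R v)) (at r)"
      by (auto intro!: derivative_eq_intros)
    from has_derivative_compose[OF this has_derivative_dd[OF assms(2)[OF that]]]
    have 1: "((\<lambda>r. f (x + r *\<^sub>R v)) has_derivative (\<lambda>h. dd (h *\<^sub>R v) f (x + r *\<^sub>R v))) (at r)" .
    have "dd (h *\<^sub>R v) f (x + r *\<^sub>R v) = h * dd v f (x + r *\<^sub>R v)" for h
      using linear_cmul[OF has_derivative_linear[OF has_derivative_dd[OF assms(2)[OF that]]]] by simp
    then show ?thesis using 1 by (simp add: has_field_derivative_def mult.commute[of _ "dd v f (x + r *\<^sub>R v)"] mult_commute_abs)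
  qed
  obtain z where "0 < z" "z < s" "f (x + s *\<^sub>R v) - f (x + 0 *\<^sub>R v) = (s - 0) * dd v f (x + z *\<^sub>R v)"
    using MVT2[OF assms(1), of "\<lambda>r. f (x + r *\<^sub>R v)" "\<lambda>r. dd v f (x + r *\<^sub>R v)"] D by auto
  then show ?thesis by auto
qed

lemma dd_second_difference:
  fixes f :: "'a::real_normed_vector \<Rightarrow> real"
  assumes "open U" "smooth_on U f" "s > 0"
    and U: "\<And>p q. 0 \<le> p \<Longrightarrow> p \<le> s \<Longrightarrow> 0 \<le> q \<Longrightarrow> q \<le> s \<Longrightarrow> x + p *\<^sub>R v + q *\<^sub>R w \<in> U"
  shows "\<exists>p q. 0 < p \<and> p < s \<and> 0 < q \<and> q < s \<and>
    f (x + s *\<^sub>R v + s *\<^sub>R w) - f (x + s *\<^sub>R v) - f (x + s *\<^sub>R w) + f x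
      = s * (s * dd w (dd v f) (x + p *\<^sub>R v + q *\<^sub>R w))"
proof -
  let ?g = "\<lambda>y. f (y + s *\<^sub>R w) - f y"
  have D: "(?g has_derivative (\<lambda>u. dd u f (x + r *\<^sub>R v + s *\<^sub>R w) - dd u f (x + r *\<^sub>R v))) (at (x + r *\<^sub>R v))"
    if r: "0 \<le> r" "r \<le> s" for r
  proof (rule has_derivative_diff)
    have "(f has_derivative (\<lambda>u. dd u f (x + r *\<^sub>R v + s *\<^sub>R w))) (at (x + r *\<^sub>R v + s *\<^sub>R w))"
      using smooth_on_has_derivative[OF assms(1,2)] U r assms(3) by simp
    moreover have "((\<lambda>y. y + s *\<^sub>R w) has_derivative (\<lambda>u. u)) (at (x + r *\<^sub>R v))"
      by (auto intro!: derivative_eq_intros)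
    ultimately show "((\<lambda>y. f (y + s *\<^sub>R w)) has_derivative (\<lambda>u. dd u f (x + r *\<^sub>R v + s *\<^sub>R w))) (at (x + r *\<^sub>R v))"
      using has_derivative_compose by fastforce
    show "(f has_derivative (\<lambda>u. dd u f (x + r *\<^sub>R v))) (at (x + r *\<^sub>R v))"
      using smooth_on_has_derivative[OF assms(1,2)] U[of r 0] r assms(3) by simp
  qed
  then obtain p where p: "0 < p" "p < s" "?g (x + s *\<^sub>R v) - ?g x = s * dd v ?g (x + p *\<^sub>R v)"
    using dd_mvt[OF assms(3), of ?g x v] differentiable_def by blast
  have "dd v ?g (x + p *\<^sub>R v) = dd v f (x + p *\<^sub>R v + s *\<^sub>R w) - dd v f (x + p *\<^sub>R v)"
    using dd_eqI[OF D] p by simp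
  moreover obtain q where "0 < q" "q < s"
    "dd v f (x + p *\<^sub>R v + s *\<^sub>R w) - dd v f (x + p *\<^sub>R v) = s * dd w (dd v f) (x + p *\<^sub>R v + q *\<^sub>R w)"
    using dd_mvt[OF assms(3) smooth_on_differentiable[OF assms(1) smooth_on_dd[OF assms(1,2)]],
        of "x + p *\<^sub>R v" w v] U p assms(3) by force
  ultimately show ?thesis using p by (intro exI[of _ p] exI[of _ q]) (auto simp: algebra_simps)
qed

text \<open>The second difference over the parallelogram spanned by s v and s w is symmetric in v
  and w, and it is s^2 times either mixed derivative at some point of the parallelogram. Continuity
  of both derivatives at \<open>x\<close> then identifies them.\<close>

lemma dd_commute:
  fixes f :: "'a::real_normed_vector \<Rightarrow> real"
  assumes "open U" "smooth_on U f" "x \<in> U"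
  shows "dd v (dd w f) x = dd w (dd v f) x"
proof -
  obtain e where e: "e > 0" "ball x e \<subseteq> U" using assms openE by blast
  \<comment> \<open>Every point of the parallelogram has distance less than \<open>s * N\<close>
    from \<open>x\<close>; the summand 1 keeps this strict if both vectors vanish.\<close>
  define N where "N = norm v + norm w + 1"
  have N: "N > 0" "norm v + norm w < N" by (auto simp: N_def add_nonneg_pos)
  have close: "dist (x + p *\<^sub>R v + q *\<^sub>R w) x < s * N" if "0 \<le> p" "p \<le> s" "0 \<le> q" "q \<le> s" "0 < s" for p q s
  proof -
    have "dist (x + p *\<^sub>R v + q *\<^sub>R w) x \<le> p * norm v + q * norm w"
      using norm_triangle_ineq[of "p *\<^sub>R v" "q *\<^sub>R w"] that by (simp add: dist_norm add.assoc)
    also have "\<dots> \<le> s * norm v + s * norm w"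
      using that by (intro add_mono mult_right_mono) auto
    also have "\<dots> < s * N" using N that by (metis distrib_left mult_strict_left_mono)
    finally show ?thesis .
  qed
  define A B where "A = dd w (dd v f)" and "B = dd v (dd w f)"
  have cont: "continuous (at x) A" "continuous (at x) B"
    unfolding A_def B_def
    by (intro differentiable_imp_continuous_within smooth_on_differentiable[OF assms(1)]
        smooth_on_dd assms)+
  have "\<bar>A x - B x\<bar> \<le> c" if "c > 0" for c
  proof -
    obtain d1 where d1: "d1 > 0" "\<And>y. dist y x < d1 \<Longrightarrow> dist (A y) (A x) < c/2"
      using cont(1) \<open>c > 0\<close> unfolding continuous_at_eps_delta by (meson half_gt_zero)
    obtain d2 where d2: "d2 > 0" "\<And>y. dist y x < d2 \<Longrightarrow> dist (B y) (B x) < c/2"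
      using cont(2) \<open>c > 0\<close> unfolding continuous_at_eps_delta by (meson half_gt_zero)
    define s where "s = min e (min d1 d2) / N"
    have s: "s > 0" "s * N \<le> e" "s * N \<le> d1" "s * N \<le> d2" using N e d1 d2 by (auto simp: s_def)
    have U: "x + p *\<^sub>R v + q *\<^sub>R w \<in> U" if "0 \<le> p" "p \<le> s" "0 \<le> q" "q \<le> s" for p q
      using close[OF that s(1)] e s by (auto simp: dist_commute)
    obtain p q where pq: "0 < p" "p < s" "0 < q" "q < s"
      "f (x + s *\<^sub>R v + s *\<^sub>R w) - f (x + s *\<^sub>R v) - f (x + s *\<^sub>R w) + f x
       = s * (s * A (x + p *\<^sub>R v + q *\<^sub>R w))"
      unfolding A_def using dd_second_difference[OF assms(1,2) s(1) U] by blast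
    have U': "x + q *\<^sub>R w + p *\<^sub>R v \<in> U" if "0 \<le> p" "p \<le> s" "0 \<le> q" "q \<le> s" for p q
      using U[OF that] by (simp add: algebra_simps)
    obtain p' q' where pq': "0 < p'" "p' < s" "0 < q'" "q' < s"
      "f (x + s *\<^sub>R w + s *\<^sub>R v) - f (x + s *\<^sub>R w) - f (x + s *\<^sub>R v) + f x
       = s * (s * B (x + q' *\<^sub>R w + p' *\<^sub>R v))"
      unfolding B_def using dd_second_difference[OF assms(1,2) s(1) U'] by blast
    have "A (x + p *\<^sub>R v + q *\<^sub>R w) = B (x + q' *\<^sub>R w + p' *\<^sub>R v)"
      using pq(5) pq'(5) s(1) by (simp add: algebra_simps)
    moreover have "dist (A (x + p *\<^sub>R v + q *\<^sub>R w)) (A x) < c/2"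
      using close[of p s q] pq s by (intro d1) auto
    moreover have "dist (B (x + q' *\<^sub>R w + p' *\<^sub>R v)) (B x) < c/2"
      using close[of p' s q'] pq' s by (intro d2) (auto simp: algebra_simps)
    ultimately show ?thesis unfolding dist_real_def by linarith
  qed
  then have "A x = B x" using dense_ge[of 0 "\<bar>A x - B x\<bar>"] by simp
  then show ?thesis by (simp add: A_def B_def)
qed

text \<open>A positive second derivative would make the first one positive just after
  \<open>z\<close>, and \<open>f\<close> would exceed its maximum. The maximum is taken along one
  line, so it may be a maximum in space at a fixed time.\<close>

lemma second_derivative_nonpos:
  fixes f :: "'a::real_normed_vector \<Rightarrow> real"
  assumes D: "open D" and f: "smooth_on D f" and z: "z \<in> D"
    and max: "\<And>r. z + r *\<^sub>R v \<in> D \<Longrightarrow> f (z + r *\<^sub>R v) \<le> f z" and crit: "dd v f z = 0"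
  shows "dd v (dd v f) z \<le> 0"
proof (rule ccontr)
  assume "\<not> ?thesis"
  then have pos: "dd v (dd v f) z > 0" by simp
  have g: "((\<lambda>r. dd v f (z + r *\<^sub>R v)) has_real_derivative dd v (dd v f) z) (at 0)"
  proof -
    have "((\<lambda>r. z + r *\<^sub>R v) has_derivative (\<lambda>h. h *\<^sub>R v)) (at 0)"
      by (auto intro!: derivative_eq_intros)
    then have "((\<lambda>r. dd v f (z + r *\<^sub>R v)) has_derivative (\<lambda>h. dd (h *\<^sub>R v) (dd v f) z)) (at 0)"
      by (rule has_derivative_compose) (use smooth_on_has_derivative[OF D smooth_on_dd[OF D f] z] in simp)
    moreover have "dd (h *\<^sub>R v) (dd v f) z = dd v (dd v f) z * h" for h
      using linear_cmul[OF dd_linear[OF D smooth_on_dd[OF D f] z]] by simp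
    ultimately show ?thesis by (simp add: has_field_derivative_def)
  qed
  obtain d where d: "d > 0" "\<And>h. 0 < h \<Longrightarrow> h < d \<Longrightarrow> dd v f (z + h *\<^sub>R v) > 0"
    using DERIV_pos_inc_right[OF g pos] crit by auto
  have "open ((\<lambda>r. z + r *\<^sub>R v) -` D)" by (intro open_vimage D continuous_intros)
  moreover have "0 \<in> (\<lambda>r. z + r *\<^sub>R v) -` D" using z by simp
  ultimately obtain e where e: "e > 0" "ball 0 e \<subseteq> (\<lambda>r. z + r *\<^sub>R v) -` D" by (rule openE)
  define s where "s = min d e / 2"
  have s: "s > 0" "s < d" "s < e" using d(1) e(1) by (auto simp: s_def)
  have seg: "z + r *\<^sub>R v \<in> D" if "0 \<le> r" "r \<le> s" for r
  proof -
    have "r \<in> ball 0 e" using that s by (simp add: dist_real_def)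
    then show ?thesis using e(2) by auto
  qed
  then obtain r where r: "0 < r" "r < s" "f (z + s *\<^sub>R v) - f z = s * dd v f (z + r *\<^sub>R v)"
    using dd_mvt[OF s(1), of f z v] smooth_on_differentiable[OF D f] by blast
  have "dd v f (z + r *\<^sub>R v) > 0" using d(2) r s by auto
  then have "s * dd v f (z + r *\<^sub>R v) > 0" using s(1) by simp
  then show False using r(3) max[OF seg[of s]] s(1) by simp
qed

section \<open>Derivations along smooth vector fields\<close>

definition LD :: "('a \<Rightarrow> 'a::real_normed_vector) \<Rightarrow> ('a \<Rightarrow> real) \<Rightarrow> 'a \<Rightarrow> real" where
  "LD E f x = dd (E x) f x"

lemma LD_const: "LD E (\<lambda>x. c) x = 0"
  by (simp add: LD_def dd_const)

context
  fixes D :: "'a::euclidean_space set"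
  assumes D: "open D"
begin

lemma dd_expand:
  fixes f :: "'a \<Rightarrow> real"
  assumes "smooth_on D f" "x \<in> D"
  shows "dd v f x = (\<Sum>i\<in>Basis. (v \<bullet> i) * dd i f x)"
proof -
  interpret linear "\<lambda>v. dd v f x" by (rule dd_linear[OF D assms])
  have "dd v f x = dd (\<Sum>i\<in>Basis. (v \<bullet> i) *\<^sub>R i) f x" by (simp add: euclidean_representation)
  also have "\<dots> = (\<Sum>i\<in>Basis. (v \<bullet> i) * dd i f x)" by (simp add: sum scale)
  finally show ?thesis .
qed

lemma LD_cong:
  assumes "\<And>y. y \<in> D \<Longrightarrow> f y = g y" "x \<in> D"
  shows "LD E f x = LD E g x"
  unfolding LD_def by (rule dd_cong_open[OF D assms(2,1)])

lemma smooth_on_LD: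
  assumes "smooth_on D E" "smooth_on D f"
  shows "smooth_on D (LD E f)"
proof -
  have "smooth_on D (\<lambda>x. \<Sum>i\<in>Basis. (E x \<bullet> i) * dd i f x)"
    by (intro smooth_on_sum smooth_on_mult smooth_on_inner smooth_on_dd smooth_on_const assms D)
  then show ?thesis
    by (rule smooth_on_cong[OF D]) (simp add: LD_def dd_expand[OF assms(2), symmetric])
qed

lemma LD_add:
  "smooth_on D f \<Longrightarrow> smooth_on D g \<Longrightarrow> x \<in> D \<Longrightarrow> LD E (\<lambda>x. f x + g x) x = LD E f x + LD E g x"
  unfolding LD_def by (rule dd_add[OF D])

lemma LD_mult:
  "smooth_on D f \<Longrightarrow> smooth_on D g \<Longrightarrow> x \<in> D \<Longrightarrow> LD E (\<lambda>x. f x * g x) x = f x * LD E g x + LD E f x * g x"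
  unfolding LD_def by (rule dd_bilinear[OF D bounded_bilinear_mult])

lemma LD_cmult:
  "smooth_on D f \<Longrightarrow> x \<in> D \<Longrightarrow> LD E (\<lambda>x. c * f x) x = c * LD E f x"
  using LD_mult[OF smooth_on_const[OF D], of f x E c] by (simp add: LD_const)

lemma LD_diff:
  assumes "smooth_on D f" "smooth_on D g" "x \<in> D"
  shows "LD E (\<lambda>x. f x - g x) x = LD E f x - LD E g x"
proof -
  have "LD E (\<lambda>x. f x + (-1) * g x) x = LD E f x + LD E (\<lambda>x. (-1) * g x) x"
    by (intro LD_add smooth_on_mult smooth_on_const assms D)
  then show ?thesis using LD_cmult[OF assms(2,3), of E "-1"] by simp
qed

lemma LD_sum:
  assumes "\<And>i. i \<in> I \<Longrightarrow> smooth_on D (f i)" "x \<in> D"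
  shows "LD E (\<lambda>x. \<Sum>i\<in>I. f i x) x = (\<Sum>i\<in>I. LD E (f i) x)"
  using assms(1)
proof (induction I rule: infinite_finite_induct)
  case (insert i I)
  then show ?case
    using LD_add[of "f i" "\<lambda>x. \<Sum>i\<in>I. f i x" x E] smooth_on_sum[OF D, of I f] assms(2) by simp
qed (simp_all add: LD_const)

lemma LD_LD_mult:
  assumes "smooth_on D E" "smooth_on D F" "smooth_on D f" "smooth_on D g" "x \<in> D"
  shows "LD E (LD F (\<lambda>x. f x * g x)) x
    = f x * LD E (LD F g) x + LD E f x * LD F g x + LD F f x * LD E g x + LD E (LD F f) x * g x"
proof -
  have "LD E (LD F (\<lambda>x. f x * g x)) x = LD E (\<lambda>x. f x * LD F g x + LD F f x * g x) x"
    by (rule LD_cong) (auto intro: LD_mult assms)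
  also have "\<dots> = LD E (\<lambda>x. f x * LD F g x) x + LD E (\<lambda>x. LD F f x * g x) x"
    by (intro LD_add smooth_on_mult smooth_on_LD assms D)
  finally show ?thesis by (simp add: LD_mult smooth_on_LD assms algebra_simps)
qed

text \<open>The first summand comes from the variation of the field, the second is the Hessian of
  \<open>f\<close> in frozen directions. Antisymmetrised this gives the Lie bracket; at a critical
  point of \<open>f\<close> only the Hessian is left.\<close>

lemma LD_LD_expand:
  assumes "smooth_on D E" "smooth_on D F" "smooth_on D f" "x \<in> D"
  shows "LD E (LD F f) x = dd (dd (E x) F x) f x + dd (E x) (dd (F x) f) x"
proof -
  have sm: "smooth_on D (\<lambda>y. F y \<bullet> j)" for j
    by (intro smooth_on_inner smooth_on_const D assms)
  have inner: "dd v (\<lambda>y. F y \<bullet> j) x = dd v F x \<bullet> j" for v j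
    using dd_bilinear[OF D bounded_bilinear_inner assms(2) smooth_on_const[OF D] assms(4), of v j]
    by (simp add: dd_const)
  have "LD E (LD F f) x = LD E (\<lambda>y. \<Sum>j\<in>Basis. (F y \<bullet> j) * dd j f y) x"
    by (rule LD_cong) (simp_all add: LD_def assms dd_expand[symmetric])
  also have "\<dots> = (\<Sum>j\<in>Basis. LD E (\<lambda>y. (F y \<bullet> j) * dd j f y) x)"
    by (intro LD_sum smooth_on_mult smooth_on_inner smooth_on_const smooth_on_dd assms D)
  also have "\<dots> = (\<Sum>j\<in>Basis. (dd (E x) F x \<bullet> j) * dd j f x + (F x \<bullet> j) * dd (E x) (dd j f) x)"
    unfolding LD_mult[OF sm smooth_on_dd[OF D assms(3)] assms(4)] by (simp add: LD_def inner add.commute)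
  also have "\<dots> = dd (dd (E x) F x) f x + (\<Sum>j\<in>Basis. (F x \<bullet> j) * dd (E x) (dd j f) x)"
    using assms by (simp add: sum.distrib dd_expand[of f x "dd (E x) F x"])
  also have "(\<Sum>j\<in>Basis. (F x \<bullet> j) * dd (E x) (dd j f) x) = LD E (\<lambda>y. \<Sum>j\<in>Basis. (F x \<bullet> j) * dd j f y) x"
    by (subst LD_sum) (simp_all add: LD_cmult smooth_on_dd smooth_on_mult smooth_on_const D assms, simp add: LD_def)
  also have "\<dots> = dd (E x) (dd (F x) f) x"
    unfolding LD_def by (rule dd_cong_open[OF D assms(4)]) (simp add: dd_expand[OF assms(3)])
  finally show ?thesis .
qed

lemma LD_bracket:
  assumes "smooth_on D E" "smooth_on D F" "smooth_on D f" "x \<in> D"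
  shows "LD E (LD F f) x - LD F (LD E f) x = dd (dd (E x) F x - dd (F x) E x) f x"
  using LD_LD_expand[OF assms] LD_LD_expand[OF assms(2,1,3,4)] dd_commute[OF D assms(3,4)]
    linear_diff[OF dd_linear[OF D assms(3,4)]] by simp

text \<open>Fields with constant derivatives along a coordinate system commute, because
  their bracket is annihilated by every coordinate.\<close>
lemma LD_commute:
  assumes "smooth_on D E" "smooth_on D F" "smooth_on D f" "x \<in> D"
    and "\<And>j. j \<in> J \<Longrightarrow> smooth_on D (g j)"
    and "\<And>j y. j \<in> J \<Longrightarrow> y \<in> D \<Longrightarrow> LD E (g j) y = c j"
    and "\<And>j y. j \<in> J \<Longrightarrow> y \<in> D \<Longrightarrow> LD F (g j) y = d j"
    and "\<And>v. (\<And>j. j \<in> J \<Longrightarrow> dd v (g j) x = 0) \<Longrightarrow> v = 0"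
  shows "LD E (LD F f) x = LD F (LD E f) x"
proof -
  have "dd (dd (E x) F x - dd (F x) E x) (g j) x = 0" if "j \<in> J" for j
  proof -
    have "LD E (LD F (g j)) x = LD E (\<lambda>y. d j) x" "LD F (LD E (g j)) x = LD F (\<lambda>y. c j) x"
      using assms that by (auto intro!: LD_cong)
    then show ?thesis
      using LD_bracket[OF assms(1,2) assms(5)[OF that] assms(4)] by (simp add: LD_const)
  qed
  then have "dd (E x) F x - dd (F x) E x = 0" by (rule assms(8))
  then show ?thesis
    using LD_bracket[OF assms(1-4)] linear_0[OF dd_linear[OF D assms(3,4)]] by simp
qed

end

section \<open>The pointwise estimate\<close>

text \<open>The gradient terms combine to \<open>- 2 u (1 - 2 e)\<^sup>2 p\<^sup>2 - 2 u (1 + 2 e)\<^sup>2 q\<^sup>2\<close>, where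
  \<open>e = (al - ga) / (2 u)\<close> and \<open>(p, q)\<close> is the gradient of \<open>u\<close>.\<close>
lemma gradient_terms_nonpos:
  fixes al ga u M t111 t112 t122 t222 :: real
  assumes u: "u = al + ga" "u > 0" and M: "al\<^sup>2 + ga\<^sup>2 - u\<^sup>2 / 2 = M * u"
    and c1: "2 * al * t111 + 2 * ga * t122 = (u + M) * (t111 + t122)"
    and c2: "2 * al * t112 + 2 * ga * t222 = (u + M) * (t112 + t222)"
  shows "4 * al * (t111 + t122)\<^sup>2 + 4 * ga * (t112 + t222)\<^sup>2
      - 2 * M * ((t111 + t122)\<^sup>2 + (t112 + t222)\<^sup>2)
    \<le> 4 * u * (t111\<^sup>2 + 3 * t122\<^sup>2 + 3 * t112\<^sup>2 + t222\<^sup>2)"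
proof -
  define d p q where "d = (al - ga) / 2" and "p = t111 + t122" and "q = t112 + t222"
  have ag: "al = u / 2 + d" "ga = u / 2 - d" using u by (auto simp: d_def field_simps)
  have Mu: "M * u = 2 * d\<^sup>2" using M unfolding ag by (simp add: power2_eq_square algebra_simps)
  show ?thesis
  \<comment> \<open>At an umbilic point \<open>c1\<close> and \<open>c2\<close> carry no
    information, but then \<open>M\<close> vanishes and (x + y)^2 <= 2 (x^2 + y^2) suffices.\<close>
  proof (cases "d = 0")
    case True
    then have "M = 0" using Mu u by simp
    have "2 * p\<^sup>2 \<le> 4 * (t111\<^sup>2 + t122\<^sup>2)" "2 * q\<^sup>2 \<le> 4 * (t112\<^sup>2 + t222\<^sup>2)"
      using zero_le_power2[of "t111 - t122"] zero_le_power2[of "t112 - t222"]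
      unfolding p_def q_def power2_eq_square by (auto simp: algebra_simps)
    then have "2 * p\<^sup>2 + 2 * q\<^sup>2 \<le> 4 * (t111\<^sup>2 + 3 * t122\<^sup>2 + 3 * t112\<^sup>2 + t222\<^sup>2)"
      by (smt (verit) zero_le_power2)
    then have "u * (2 * p\<^sup>2 + 2 * q\<^sup>2) \<le> u * (4 * (t111\<^sup>2 + 3 * t122\<^sup>2 + 3 * t112\<^sup>2 + t222\<^sup>2))"
      using u by (intro mult_left_mono) auto
    then show ?thesis using True \<open>M = 0\<close> unfolding ag p_def[symmetric] q_def[symmetric]
      by (simp add: algebra_simps)
  next
    case False
    \<comment> \<open>Away from umbilic points the critical equations express the difference of two
      third derivatives by their sum, t111 - t122 = e p and t112 - t222 = e q, which leaves an
      identity in e, p, q, u.\<close>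
    define e where "e = d / u"
    have de: "d = e * u" using u(2) by (simp add: e_def)
    have "M * u = (2 * e\<^sup>2 * u) * u" unfolding Mu de by (simp add: power2_eq_square)
    then have Me: "M = 2 * e\<^sup>2 * u" using u(2) by simp
    have "2 * d * (t111 - t122) = M * p"
      using c1 unfolding ag p_def by (simp add: algebra_simps)
    then have "d * (t111 - t122) = d * (e * p)"
      unfolding Me using de by (simp add: power2_eq_square algebra_simps)
    then have "t111 - t122 = e * p" using False by simp
    then have t1: "t111 = p * (1 + e) / 2" "t122 = p * (1 - e) / 2"
      by (auto simp: p_def field_simps)
    have "2 * d * (t112 - t222) = M * q"
      using c2 unfolding ag q_def by (simp add: algebra_simps)
    then have "d * (t112 - t222) = d * (e * q)"
      unfolding Me using de by (simp add: power2_eq_square algebra_simps)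
    then have "t112 - t222 = e * q" using False by simp
    then have t2: "t112 = q * (1 + e) / 2" "t222 = q * (1 - e) / 2"
      by (auto simp: q_def field_simps)
    have "4 * u * (t111\<^sup>2 + 3 * t122\<^sup>2 + 3 * t112\<^sup>2 + t222\<^sup>2)
        - (4 * al * p\<^sup>2 + 4 * ga * q\<^sup>2 - 2 * M * (p\<^sup>2 + q\<^sup>2))
      = 2 * u * ((1 - 2 * e)\<^sup>2 * p\<^sup>2 + (1 + 2 * e)\<^sup>2 * q\<^sup>2)"
      unfolding ag de Me t1 t2 by (simp add: power2_eq_square field_simps)
    moreover have "\<dots> \<ge> 0" using u by simp
    ultimately show ?thesis unfolding p_def q_def by linarith
  qed
qed

text \<open>The calculus of the overview with the inverse Gauss map abstracted away. The
  \<open>n i\<close> act as Cartesian coordinates of the normal, \<open>E i\<close> as the partial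
  derivatives in them and \<open>Et\<close> as the time derivative at fixed normal;
  \<open>rho\<close> is the length of the normal. \<open>radial\<close> is Euler's relation for
  \<open>h\<close> of degree 1, and the powers of \<open>rho\<close> in \<open>flow\<close> give
  both sides degree 1.\<close>

locale support_frame =
  fixes D :: "'a::euclidean_space set" and E :: "3 \<Rightarrow> 'a \<Rightarrow> 'a" and Et :: "'a \<Rightarrow> 'a"
    and n :: "3 \<Rightarrow> 'a \<Rightarrow> real" and rho h :: "'a \<Rightarrow> real"
  assumes D: "open D"
    and smooth_E: "smooth_on D (E i)" and smooth_Et: "smooth_on D Et"
    and smooth_n: "smooth_on D (n i)" and smooth_rho: "smooth_on D rho" and smooth_h: "smooth_on D h"
    and E_commute: "smooth_on D f \<Longrightarrow> x \<in> D \<Longrightarrow> LD (E i) (LD (E j) f) x = LD (E j) (LD (E i) f) x"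
    and Et_commute: "smooth_on D f \<Longrightarrow> x \<in> D \<Longrightarrow> LD Et (LD (E j) f) x = LD (E j) (LD Et f) x"
    and E_n: "x \<in> D \<Longrightarrow> LD (E i) (n j) x = (if i = j then 1 else 0)"
    and Et_n: "x \<in> D \<Longrightarrow> LD Et (n j) x = 0"
    and rho_pos: "x \<in> D \<Longrightarrow> rho x > 0"
    and rho_sq: "x \<in> D \<Longrightarrow> rho x * rho x = (\<Sum>i\<in>UNIV. n i x * n i x)"
    and radial: "x \<in> D \<Longrightarrow> (\<Sum>j\<in>UNIV. n j x * LD (E i) (LD (E j) h) x) = 0"
    and flow: "x \<in> D \<Longrightarrow> LD Et h x = rho x * (rho x * (\<Sum>i\<in>UNIV. LD (E i) (LD (E i) h) x))\<^sup>2"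
begin

definition b :: "3 \<Rightarrow> 3 \<Rightarrow> 'a \<Rightarrow> real" where "b i j = LD (E i) (LD (E j) h)"
text \<open>The Hessian of a function of degree 1 has degree -1; the factor \<open>rho\<close> makes
  the entries constant along rays, and the eigenvalues become the principal radii and 0.\<close>

definition bet :: "3 \<Rightarrow> 3 \<Rightarrow> 'a \<Rightarrow> real" where "bet i j x = rho x * b i j x"
definition u :: "'a \<Rightarrow> real" where "u x = (\<Sum>i\<in>UNIV. bet i i x)"
text \<open>For eigenvalues r1, r2, 0 of \<open>bet\<close> the first two terms are (r1 - r2)^2 / 2,
  so with \<open>u\<close> positive the sign of \<open>phi M\<close> compares the quotient of the
  overview with \<open>M\<close>.\<close>

definition phi :: "real \<Rightarrow> 'a \<Rightarrow> real" where
  "phi M x = (\<Sum>i\<in>UNIV. \<Sum>j\<in>UNIV. bet i j x * bet i j x) - (u x * u x) / 2 - M * u x"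

lemmas smooth_rules = smooth_on_LD[OF D] smooth_on_mult[OF D] smooth_on_add[OF D] smooth_on_sum[OF D]
  smooth_on_diff[OF D] smooth_on_const[OF D] smooth_on_inner[OF D]
  smooth_E smooth_Et smooth_n smooth_rho smooth_h

lemma smooth_b: "smooth_on D (b i j)"
  unfolding b_def by (intro smooth_rules)

lemma smooth_bet: "smooth_on D (bet i j)"
  unfolding bet_def by (intro smooth_rules smooth_b)

lemma smooth_u: "smooth_on D u"
  unfolding u_def by (intro smooth_rules smooth_bet)

lemma b_sym: "x \<in> D \<Longrightarrow> b i j x = b j i x"
  unfolding b_def by (rule E_commute[OF smooth_h])

section \<open>Third and fourth derivatives of the support function\<close>

definition T :: "3 \<Rightarrow> 3 \<Rightarrow> 3 \<Rightarrow> 'a \<Rightarrow> real" where "T k i j = LD (E k) (b i j)"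
definition F :: "3 \<Rightarrow> 3 \<Rightarrow> 3 \<Rightarrow> 3 \<Rightarrow> 'a \<Rightarrow> real" where "F l k i j = LD (E l) (T k i j)"

lemma smooth_T: "smooth_on D (T k i j)"
  unfolding T_def by (intro smooth_rules smooth_b)

text \<open>The Codazzi equations, as a consequence of commuting fields. The two transpositions
  generate all permutations of the indices.\<close>

lemma T_sym: "x \<in> D \<Longrightarrow> T k i j x = T k j i x" "x \<in> D \<Longrightarrow> T k i j x = T i k j x"
proof -
  show "x \<in> D \<Longrightarrow> T k i j x = T k j i x"
    unfolding T_def by (rule LD_cong[OF D b_sym])
  show "x \<in> D \<Longrightarrow> T k i j x = T i k j x"
    unfolding T_def b_def by (rule E_commute) (intro smooth_rules)
qed

lemma F_sym:
  assumes "x \<in> D"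
  shows "F l k i j x = F l k j i x" "F l k i j x = F l i k j x" "F l k i j x = F k l i j x"
  subgoal unfolding F_def by (rule LD_cong[OF D T_sym(1) assms])
  subgoal unfolding F_def by (rule LD_cong[OF D T_sym(2) assms])
  subgoal unfolding F_def T_def by (rule E_commute[OF smooth_b assms])
  done

lemma radial_b: "x \<in> D \<Longrightarrow> (\<Sum>j\<in>UNIV. n j x * b i j x) = 0"
  using radial unfolding b_def .

text \<open>Euler's relation, differentiated. Where the normal is the third frame vector this turns
  a derivative with a radial index into one of lower order, so only tangential indices remain;
  \<open>radial_F\<close> does the same one order higher.\<close>

lemma radial_T:
  assumes "x \<in> D"
  shows "b k i x + (\<Sum>j\<in>UNIV. n j x * T k i j x) = 0"
proof -
  have "LD (E k) (\<lambda>x. \<Sum>j\<in>UNIV. n j x * b i j x) x = LD (E k) (\<lambda>x. 0) x"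
    by (rule LD_cong[OF D radial_b assms])
  also have "LD (E k) (\<lambda>x. \<Sum>j\<in>UNIV. n j x * b i j x) x = (\<Sum>j\<in>UNIV. LD (E k) (\<lambda>x. n j x * b i j x) x)"
    by (intro LD_sum[OF D] assms smooth_rules smooth_b)
  also have "\<dots> = (\<Sum>j\<in>UNIV. n j x * T k i j x + (if k = j then 1 else 0) * b i j x)"
    by (simp add: LD_mult[OF D smooth_n smooth_b assms] E_n[OF assms] T_def)
  also have "\<dots> = (\<Sum>j\<in>UNIV. n j x * T k i j x) + (\<Sum>j\<in>UNIV. if k = j then b i j x else 0)"
    unfolding sum.distrib[symmetric] by (intro sum.cong) auto
  finally show ?thesis using b_sym[OF assms, of i k] by (simp add: LD_const)
qed

lemma radial_F:
  assumes "x \<in> D"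
  shows "T l k i x + T k i l x + (\<Sum>j\<in>UNIV. n j x * F l k i j x) = 0"
proof -
  have "LD (E l) (\<lambda>x. b k i x + (\<Sum>j\<in>UNIV. n j x * T k i j x)) x = LD (E l) (\<lambda>x. 0) x"
    by (rule LD_cong[OF D radial_T assms])
  also have "LD (E l) (\<lambda>x. b k i x + (\<Sum>j\<in>UNIV. n j x * T k i j x)) x
      = LD (E l) (b k i) x + LD (E l) (\<lambda>x. \<Sum>j\<in>UNIV. n j x * T k i j x) x"
    by (intro LD_add[OF D] assms smooth_rules smooth_b smooth_T)
  also have "LD (E l) (\<lambda>x. \<Sum>j\<in>UNIV. n j x * T k i j x) x = (\<Sum>j\<in>UNIV. LD (E l) (\<lambda>x. n j x * T k i j x) x)"
    by (intro LD_sum[OF D] assms smooth_rules smooth_T)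
  also have "\<dots> = (\<Sum>j\<in>UNIV. n j x * F l k i j x + (if l = j then 1 else 0) * T k i j x)"
    by (simp add: LD_mult[OF D smooth_n smooth_T assms] E_n[OF assms] F_def)
  also have "\<dots> = (\<Sum>j\<in>UNIV. n j x * F l k i j x) + (\<Sum>j\<in>UNIV. if l = j then T k i j x else 0)"
    unfolding sum.distrib[symmetric] by (intro sum.cong) auto
  finally show ?thesis by (simp add: LD_const T_def)
qed

section \<open>The radial function, the evolution of the Hessian, derivatives of
  \<open>phi\<close>\<close>

lemma LD_rho: "x \<in> D \<Longrightarrow> rho x * LD (E i) rho x = n i x"
proof -
  assume x: "x \<in> D"
  have "LD (E i) (\<lambda>x. rho x * rho x) x = LD (E i) (\<lambda>x. \<Sum>j\<in>UNIV. n j x * n j x) x"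
    by (rule LD_cong[OF D rho_sq x])
  also have "\<dots> = (\<Sum>j\<in>UNIV. LD (E i) (\<lambda>x. n j x * n j x) x)"
    by (intro LD_sum[OF D] x smooth_rules)
  also have "\<dots> = (\<Sum>j\<in>UNIV. if i = j then 2 * n j x else 0)"
    by (intro sum.cong) (auto simp: LD_mult[OF D smooth_n smooth_n x] E_n[OF x])
  finally show ?thesis by (simp add: LD_mult[OF D smooth_rho smooth_rho x])
qed

lemma LD_Et_rho: "x \<in> D \<Longrightarrow> LD Et rho x = 0"
proof -
  assume x: "x \<in> D"
  have "LD Et (\<lambda>x. rho x * rho x) x = LD Et (\<lambda>x. \<Sum>j\<in>UNIV. n j x * n j x) x"
    by (rule LD_cong[OF D rho_sq x])
  also have "\<dots> = (\<Sum>j\<in>UNIV. LD Et (\<lambda>x. n j x * n j x) x)"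
    by (intro LD_sum[OF D] x smooth_rules)
  also have "\<dots> = 0"
    by (simp add: LD_mult[OF D smooth_n smooth_n x] Et_n[OF x])
  finally show ?thesis using rho_pos[OF x] by (simp add: LD_mult[OF D smooth_rho smooth_rho x])
qed

lemma LD_LD_rho:
  assumes "x \<in> D"
  shows "LD (E j) rho x * LD (E i) rho x + rho x * LD (E j) (LD (E i) rho) x = (if j = i then 1 else 0)"
proof -
  have "LD (E j) (\<lambda>x. rho x * LD (E i) rho x) x = LD (E j) (n i) x"
    by (rule LD_cong[OF D LD_rho assms])
  then show ?thesis
    by (simp add: LD_mult[OF D smooth_rho smooth_on_LD[OF D smooth_E smooth_rho] assms] E_n[OF assms])
qed

text \<open>\<open>Et\<close> commutes with the frame and annihilates \<open>rho\<close>, so the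
  Hessian evolves by the Hessian of the right hand side of the flow.\<close>

lemma LD_flow:
  assumes "x \<in> D"
  shows "LD Et (bet i j) x = rho x * LD (E i) (LD (E j) (\<lambda>x. rho x * (u x * u x))) x"
proof -
  have "LD Et (bet i j) x = rho x * LD Et (b i j) x"
    unfolding bet_def by (simp add: LD_mult[OF D smooth_rho smooth_b assms] LD_Et_rho[OF assms])
  also have "LD Et (b i j) x = LD (E i) (LD Et (LD (E j) h)) x"
    unfolding b_def by (intro Et_commute assms smooth_rules)
  also have "\<dots> = LD (E i) (LD (E j) (LD Et h)) x"
    by (rule LD_cong[OF D _ assms]) (rule Et_commute[OF smooth_h])
  also have "\<dots> = LD (E i) (LD (E j) (\<lambda>x. rho x * (u x * u x))) x"
    by (rule LD_cong[OF D _ assms], rule LD_cong[OF D])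
       (simp_all add: flow u_def bet_def b_def power2_eq_square sum_distrib_left)
  finally show ?thesis .
qed

lemma LD_phi:
  assumes "x \<in> D"
  shows "LD G (phi M) x = (\<Sum>i\<in>UNIV. \<Sum>j\<in>UNIV. 2 * (bet i j x * LD G (bet i j) x)) - (u x + M) * LD G u x"
proof -
  have "phi M = (\<lambda>x. (\<Sum>i\<in>UNIV. \<Sum>j\<in>UNIV. bet i j x * bet i j x) - (1/2) * (u x * u x) - M * u x)"
    by (rule ext) (simp add: phi_def)
  then have "LD G (phi M) x = LD G (\<lambda>x. (\<Sum>i\<in>UNIV. \<Sum>j\<in>UNIV. bet i j x * bet i j x) - (1/2) * (u x * u x)) x
      - LD G (\<lambda>x. M * u x) x"
    by (simp only:) (intro LD_diff[OF D] smooth_rules smooth_bet smooth_u assms)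
  also have "LD G (\<lambda>x. (\<Sum>i\<in>UNIV. \<Sum>j\<in>UNIV. bet i j x * bet i j x) - (1/2) * (u x * u x)) x
      = LD G (\<lambda>x. \<Sum>i\<in>UNIV. \<Sum>j\<in>UNIV. bet i j x * bet i j x) x - LD G (\<lambda>x. (1/2) * (u x * u x)) x"
    by (intro LD_diff[OF D] smooth_rules smooth_bet smooth_u assms)
  also have "LD G (\<lambda>x. \<Sum>i\<in>UNIV. \<Sum>j\<in>UNIV. bet i j x * bet i j x) x
      = (\<Sum>i\<in>UNIV. LD G (\<lambda>x. \<Sum>j\<in>UNIV. bet i j x * bet i j x) x)"
    by (intro LD_sum[OF D] assms smooth_rules smooth_bet)
  also have "\<dots> = (\<Sum>i\<in>UNIV. \<Sum>j\<in>UNIV. LD G (\<lambda>x. bet i j x * bet i j x) x)"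
    by (intro sum.cong refl LD_sum[OF D] assms smooth_rules smooth_bet)
  also have "\<dots> = (\<Sum>i\<in>UNIV. \<Sum>j\<in>UNIV. 2 * (bet i j x * LD G (bet i j) x))"
    by (simp add: LD_mult[OF D smooth_bet smooth_bet assms])
  also have "LD G (\<lambda>x. (1/2) * (u x * u x)) x = u x * LD G u x"
    using LD_cmult[OF D smooth_on_mult[OF D smooth_u smooth_u] assms, of G "1/2"]
    by (simp add: LD_mult[OF D smooth_u smooth_u assms])
  also have "LD G (\<lambda>x. M * u x) x = M * LD G u x"
    by (rule LD_cmult[OF D smooth_u assms])
  finally show ?thesis by (simp add: algebra_simps)
qed

lemma LD_u: "x \<in> D \<Longrightarrow> LD G u x = (\<Sum>i\<in>UNIV. LD G (bet i i) x)"
  unfolding u_def by (intro LD_sum[OF D] smooth_bet)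

lemma LD_LD_u:
  assumes "x \<in> D" "smooth_on D G'"
  shows "LD G (LD G' u) x = (\<Sum>i\<in>UNIV. LD G (LD G' (bet i i)) x)"
proof -
  have "LD G (LD G' u) x = LD G (\<lambda>x. \<Sum>i\<in>UNIV. LD G' (bet i i) x) x"
    by (rule LD_cong[OF D LD_u assms(1)])
  also have "\<dots> = (\<Sum>i\<in>UNIV. LD G (LD G' (bet i i)) x)"
    by (intro LD_sum[OF D] assms smooth_rules smooth_bet)
  finally show ?thesis .
qed

lemma LD_LD_phi:
  assumes "x \<in> D" "smooth_on D G"
  shows "LD G (LD G (phi M)) x
    = (\<Sum>i\<in>UNIV. \<Sum>j\<in>UNIV. 2 * ((LD G (bet i j) x)\<^sup>2 + bet i j x * LD G (LD G (bet i j)) x))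
      - (LD G u x)\<^sup>2 - (u x + M) * LD G (LD G u) x"
proof -
  note sm = smooth_rules smooth_bet smooth_u assms(2)
  have "LD G (LD G (phi M)) x
      = LD G (\<lambda>x. (\<Sum>i\<in>UNIV. \<Sum>j\<in>UNIV. 2 * (bet i j x * LD G (bet i j) x)) - (u x + M) * LD G u x) x"
    by (rule LD_cong[OF D LD_phi assms(1)])
  also have "\<dots> = LD G (\<lambda>x. \<Sum>i\<in>UNIV. \<Sum>j\<in>UNIV. 2 * (bet i j x * LD G (bet i j) x)) x
      - LD G (\<lambda>x. (u x + M) * LD G u x) x"
    by (intro LD_diff[OF D] assms sm)
  also have "LD G (\<lambda>x. \<Sum>i\<in>UNIV. \<Sum>j\<in>UNIV. 2 * (bet i j x * LD G (bet i j) x)) x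
      = (\<Sum>i\<in>UNIV. LD G (\<lambda>x. \<Sum>j\<in>UNIV. 2 * (bet i j x * LD G (bet i j) x)) x)"
    by (intro LD_sum[OF D] assms sm)
  also have "\<dots> = (\<Sum>i\<in>UNIV. \<Sum>j\<in>UNIV. LD G (\<lambda>x. 2 * (bet i j x * LD G (bet i j) x)) x)"
    by (intro sum.cong refl LD_sum[OF D] assms sm)
  also have "\<dots> = (\<Sum>i\<in>UNIV. \<Sum>j\<in>UNIV. 2 * ((LD G (bet i j) x)\<^sup>2 + bet i j x * LD G (LD G (bet i j)) x))"
  proof (intro sum.cong refl)
    fix i j
    have "LD G (\<lambda>x. 2 * (bet i j x * LD G (bet i j) x)) x = 2 * LD G (\<lambda>x. bet i j x * LD G (bet i j) x) x"
      by (intro LD_cmult[OF D] assms sm)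
    also have "LD G (\<lambda>x. bet i j x * LD G (bet i j) x) x
        = bet i j x * LD G (LD G (bet i j)) x + LD G (bet i j) x * LD G (bet i j) x"
      by (intro LD_mult[OF D] assms sm)
    finally show "LD G (\<lambda>x. 2 * (bet i j x * LD G (bet i j) x)) x
        = 2 * ((LD G (bet i j) x)\<^sup>2 + bet i j x * LD G (LD G (bet i j)) x)"
      by (simp add: power2_eq_square)
  qed
  also have "LD G (\<lambda>x. (u x + M) * LD G u x) x = (u x + M) * LD G (LD G u) x + LD G (\<lambda>x. u x + M) x * LD G u x"
    by (intro LD_mult[OF D] assms sm)
  also have "LD G (\<lambda>x. u x + M) x = LD G u x"
    using LD_add[OF D smooth_u smooth_on_const[OF D] assms(1), of G M] by (simp add: LD_const)
  finally show ?thesis by (simp add: power2_eq_square)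
qed

lemma LD_bet: "x \<in> D \<Longrightarrow> LD (E k) (bet i j) x = rho x * T k i j x + LD (E k) rho x * b i j x"
  unfolding bet_def T_def by (rule LD_mult[OF D smooth_rho smooth_b])

lemma LD_LD_bet:
  assumes "x \<in> D"
  shows "LD (E l) (LD (E k) (bet i j)) x = rho x * F l k i j x + LD (E l) rho x * T k i j x
    + LD (E k) rho x * T l i j x + LD (E l) (LD (E k) rho) x * b i j x"
  unfolding bet_def T_def F_def
  by (rule LD_LD_mult[OF D smooth_E smooth_E smooth_rho smooth_b assms])

lemma LD_LD_rho_u2:
  assumes "x \<in> D"
  shows "LD (E i) (LD (E j) (\<lambda>x. rho x * (u x * u x))) x
    = rho x * (2 * (u x * LD (E i) (LD (E j) u) x + LD (E i) u x * LD (E j) u x))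
      + 2 * u x * (LD (E i) rho x * LD (E j) u x + LD (E j) rho x * LD (E i) u x)
      + LD (E i) (LD (E j) rho) x * (u x)\<^sup>2"
proof -
  have s: "smooth_on D (\<lambda>x. u x * u x)" by (intro smooth_rules smooth_u)
  show ?thesis
    unfolding LD_LD_mult[OF D smooth_E smooth_E smooth_rho s assms]
      LD_LD_mult[OF D smooth_E smooth_E smooth_u smooth_u assms] LD_mult[OF D smooth_u smooth_u assms]
    by (simp add: algebra_simps power2_eq_square)
qed

text \<open>The frame is adapted to \<open>z\<close>: \<open>E 3\<close> is radial and the second derivatives of \<open>h\<close> are diagonal.\<close>
lemma maximum_point_estimate:
  assumes z: "z \<in> D" and nz: "n 1 z = 0" "n 2 z = 0" "n 3 z = 1" and b12: "b 1 2 z = 0"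
    and upos: "u z > 0" and phi0: "phi M z = 0"
    and crit: "\<And>i. LD (E i) (phi M) z = 0" and hess: "\<And>i. LD (E i) (LD (E i) (phi M)) z \<le> 0"
  shows "LD Et (phi M) z \<le> 0"
proof -
  have "rho z * rho z = 1" using rho_sq[OF z] nz by (simp add: sum_3)
  then have rho: "rho z = 1" using rho_pos[OF z] square_eq_1_iff by fastforce
  \<comment> \<open>At \<open>z\<close> the gradient of \<open>rho\<close> is radial and, by
    \<open>r2\<close>, its Hessian is the projection to the tangential directions.\<close>
  have r1: "LD (E 1) rho z = 0" "LD (E 2) rho z = 0" "LD (E 3) rho z = 1"
    using LD_rho[OF z] rho nz by auto
  have r2: "LD (E j) (LD (E i) rho) z = (if j = i \<and> i \<noteq> 3 then 1 else 0)" for i j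
    using LD_LD_rho[OF z, of j i] r1 rho exhaust_3[of i] exhaust_3[of j] by auto
  have b3: "b i 3 z = 0" "b 3 i z = 0" for i
    using radial_b[OF z, of i] b_sym[OF z, of i 3] nz by (auto simp: sum_3)
  have T3: "T k i 3 z = - b k i z" for k i
    using radial_T[OF z, of k i] nz by (simp add: sum_3)
  have F3: "F l k i 3 z = - 2 * T l k i z" for l k i
    using radial_F[OF z, of l k i] nz T_sym[OF z] by (simp add: sum_3)
  define al ga where "al = b 1 1 z" and "ga = b 2 2 z"
  define t111 t112 t122 t222 where
    "t111 = T 1 1 1 z" and "t112 = T 1 1 2 z" and "t122 = T 1 2 2 z" and "t222 = T 2 2 2 z"
  have b21: "b 2 1 z = 0" using b12 b_sym[OF z] by metis
  have bv: "b 1 1 z = al" "b 2 2 z = ga" by (simp_all add: al_def ga_def)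
  have Tv: "T 1 1 1 z = t111" "T 1 1 2 z = t112" "T 1 2 1 z = t112" "T 2 1 1 z = t112"
     "T 1 2 2 z = t122" "T 2 1 2 z = t122" "T 2 2 1 z = t122" "T 2 2 2 z = t222"
    using T_sym[OF z] by (metis t111_def t112_def t122_def t222_def)+
  have T3': "T k 3 i z = - b k i z" "T 3 k i z = - b k i z" for k i
    using T3 T_sym[OF z] by metis+
  note vals = rho r1 r2 b3 b12 b21 bv T3 T3' Tv
  have bet: "bet i j z = b i j z" for i j by (simp add: bet_def rho)
  have uz: "u z = al + ga" by (simp add: u_def sum_3 bet b3 bv)
  have Dbet: "LD (E k) (bet i j) z = T k i j z + LD (E k) rho z * b i j z" for k i j
    by (simp add: LD_bet[OF z] rho)
  have u1: "LD (E 1) u z = t111 + t122" "LD (E 2) u z = t112 + t222" "LD (E 3) u z = 0"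
    by (simp_all add: LD_u[OF z] sum_3 Dbet vals)
  define F1111 F1122 F2222 where "F1111 = F 1 1 1 1 z" and "F1122 = F 1 1 2 2 z" and "F2222 = F 2 2 2 2 z"
  have Fv: "F 1 1 1 1 z = F1111" "F 1 1 2 2 z = F1122" "F 2 2 1 1 z = F1122" "F 2 2 2 2 z = F2222"
    using F_sym[OF z] by (metis F1111_def F1122_def F2222_def)+
  have F33: "F k k 3 3 z = 2 * b k k z" for k
    using F3[of k k 3] T3'[of k k] T3[of k k] by simp
  have Fr: "F 3 3 i i z = 2 * b i i z" for i
    using F33[of i] F_sym[OF z] by metis
  have U11: "LD (E 1) (LD (E 1) u) z = F1111 + F1122 + 3 * al + ga"
    by (simp add: LD_LD_u[OF z smooth_E] sum_3 LD_LD_bet[OF z] vals Fv F33)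
  have U22: "LD (E 2) (LD (E 2) u) z = F1122 + F2222 + al + 3 * ga"
    by (simp add: LD_LD_u[OF z smooth_E] sum_3 LD_LD_bet[OF z] vals Fv F33)
  have U33: "LD (E 3) (LD (E 3) u) z = 0"
    by (simp add: LD_LD_u[OF z smooth_E] sum_3 LD_LD_bet[OF z] vals Fr)
  \<comment> \<open>The second derivatives of the unscaled trace of \<open>b\<close> in the two
    tangential directions; those of \<open>u\<close> exceed them by \<open>u z\<close>, from the
    Hessian of \<open>rho\<close>. By the symmetry of \<open>F\<close> they are also the tangential
    Laplacians of the two diagonal entries of \<open>bet\<close>.\<close>
  define V1 V2 where "V1 = F1111 + F1122 + 2 * al" and "V2 = F1122 + F2222 + 2 * ga"
  have M: "al\<^sup>2 + ga\<^sup>2 - (u z)\<^sup>2 / 2 = M * u z"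
    using phi0 by (simp add: phi_def sum_3 bet vals power2_eq_square)
  have c1: "2 * al * t111 + 2 * ga * t122 = (u z + M) * (t111 + t122)"
    using crit[of 1] by (simp add: LD_phi[OF z] sum_3 bet Dbet vals u1)
  have c2: "2 * al * t112 + 2 * ga * t222 = (u z + M) * (t112 + t222)"
    using crit[of 2] by (simp add: LD_phi[OF z] sum_3 bet Dbet vals u1)
  define P where "P = (t111 + t122)\<^sup>2 + (t112 + t222)\<^sup>2"
  \<comment> \<open>The sum of the second derivative tests in the two tangential directions. The
    term with al^2 + ga^2 comes from those first derivatives of \<open>bet\<close> that have a
    radial index, evaluated by \<open>T3\<close>.\<close>
  have H: "2 * (t111\<^sup>2 + 3 * t112\<^sup>2 + 3 * t122\<^sup>2 + t222\<^sup>2 + 2 * (al\<^sup>2 + ga\<^sup>2))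
      + 2 * al * V1 + 2 * ga * V2 - P - (u z + M) * (V1 + V2 + 2 * u z) \<le> 0"
    using add_mono[OF hess[of 1] hess[of 2]]
    by (simp add: LD_LD_phi[OF z smooth_E] sum_3 bet Dbet LD_LD_bet[OF z] vals u1 U11 U22 Fv V1_def V2_def P_def uz
        algebra_simps)
  have Et: "LD Et (bet i j) z = LD (E i) (LD (E j) (\<lambda>x. rho x * (u x * u x))) z" for i j
    by (simp add: LD_flow[OF z] rho)
  have E11: "LD Et (bet 1 1) z = 2 * (u z * (V1 + u z) + (t111 + t122)\<^sup>2) + (u z)\<^sup>2"
    by (simp add: Et LD_LD_rho_u2[OF z] vals u1 U11 V1_def uz power2_eq_square algebra_simps)
  have E22: "LD Et (bet 2 2) z = 2 * (u z * (V2 + u z) + (t112 + t222)\<^sup>2) + (u z)\<^sup>2"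
    by (simp add: Et LD_LD_rho_u2[OF z] vals u1 U22 V2_def uz power2_eq_square algebra_simps)
  have E33: "LD Et (bet 3 3) z = 0"
    by (simp add: Et LD_LD_rho_u2[OF z] vals u1 U33)
  have L: "LD Et (phi M) z = 2 * al * LD Et (bet 1 1) z + 2 * ga * LD Et (bet 2 2) z
      - (u z + M) * (LD Et (bet 1 1) z + LD Et (bet 2 2) z)"
    by (simp add: LD_phi[OF z] LD_u[OF z] sum_3 bet vals E33)
  have G: "4 * al * (t111 + t122)\<^sup>2 + 4 * ga * (t112 + t222)\<^sup>2 - 2 * M * P
      \<le> 4 * u z * (t111\<^sup>2 + 3 * t122\<^sup>2 + 3 * t112\<^sup>2 + t222\<^sup>2)"
    unfolding P_def by (rule gradient_terms_nonpos[OF uz upos M c1 c2])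
  have "M * u z \<ge> 0"
    unfolding M[symmetric] unfolding uz using zero_le_power2[of "al - ga"] by (simp add: power2_eq_square algebra_simps)
  define S where "S = t111\<^sup>2 + 3 * t112\<^sup>2 + 3 * t122\<^sup>2 + t222\<^sup>2"
  \<comment> \<open>The weight \<open>2 * u z\<close> is the coefficient of the second derivatives
    in the linearised flow, being the derivative of the square of the trace; with it
    \<open>V1\<close> and \<open>V2\<close> cancel against those in the time derivative.\<close>
  have "2 * u z * (2 * (S + 2 * (al\<^sup>2 + ga\<^sup>2)) + 2 * al * V1 + 2 * ga * V2 - P - (u z + M) * (V1 + V2 + 2 * u z)) \<le> 0"
    using H upos unfolding S_def by (simp add: mult_nonneg_nonpos)
  \<comment> \<open>Of the constant 10, 6 comes from the zeroth-order terms of the evolution and 4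
    from those of the second derivative inequality.\<close>
  moreover have "LD Et (phi M) z
      = 2 * u z * (2 * (S + 2 * (al\<^sup>2 + ga\<^sup>2)) + 2 * al * V1 + 2 * ga * V2 - P - (u z + M) * (V1 + V2 + 2 * u z))
        + (4 * al * (t111 + t122)\<^sup>2 + 4 * ga * (t112 + t222)\<^sup>2 - 2 * M * P - 4 * u z * S) - 10 * (M * u z) * u z"
  proof -
    have ag2: "al\<^sup>2 + ga\<^sup>2 = M * u z + (u z)\<^sup>2 / 2" using M by simp
    have g: "ga = u z - al" using uz by simp
    show ?thesis
      unfolding L E11 E22 ag2 P_def unfolding g by (simp add: power2_eq_square algebra_simps)
  qed
  moreover have "(M * u z) * u z \<ge> 0" using \<open>M * u z \<ge> 0\<close> upos by simp
  moreover have "4 * al * (t111 + t122)\<^sup>2 + 4 * ga * (t112 + t222)\<^sup>2 - 2 * M * P - 4 * u z * S \<le> 0"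
    using G unfolding S_def by (simp add: algebra_simps)
  ultimately show ?thesis by linarith
qed

end

section \<open>Orthonormal frames and symmetric operators\<close>

definition orthonormal :: "(3 \<Rightarrow> real^3) \<Rightarrow> bool" where
  "orthonormal f \<longleftrightarrow> (\<forall>i j. f i \<bullet> f j = (if i = j then 1 else 0))"

text \<open>Parseval's identity: the square matrix with rows \<open>f i\<close> has its transpose as
  right inverse, hence as left inverse.\<close>

lemma orthonormal_inner:
  fixes x y :: "real^3"
  assumes "orthonormal f"
  shows "(\<Sum>i\<in>UNIV. (x \<bullet> f i) * (f i \<bullet> y)) = x \<bullet> y"
proof -
  define A :: "real^3^3" where "A = (\<chi> i. f i)"
  have "A ** transpose A = mat 1"
    using assms unfolding orthonormal_def
    by (simp add: A_def matrix_matrix_mult_def transpose_def mat_def vec_eq_iff inner_vec_def)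
  then have "transpose A ** A = mat 1" by (simp add: matrix_left_right_inverse)
  then have "x \<bullet> y = x \<bullet> (transpose A *v (A *v y))"
    by (simp add: matrix_vector_mul_assoc)
  also have "\<dots> = (A *v x) \<bullet> (A *v y)" by (metis dot_lmul_matrix vector_transpose_matrix)
  also have "\<dots> = (\<Sum>i\<in>UNIV. (f i \<bullet> x) * (f i \<bullet> y))"
    by (simp add: A_def inner_vec_def matrix_vector_mult_def)
  finally show ?thesis by (simp add: inner_commute)
qed

lemma trace_orthonormal:
  fixes T :: "real^3 \<Rightarrow> real^3"
  assumes "linear T" "orthonormal f" "orthonormal g"
  shows "(\<Sum>i\<in>UNIV. f i \<bullet> T (f i)) = (\<Sum>i\<in>UNIV. g i \<bullet> T (g i))"
proof -
  have rep: "x = (\<Sum>j\<in>UNIV. (x \<bullet> g j) *\<^sub>R g j)" for x :: "real^3"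
  proof (rule vector_eq_ldot[THEN iffD1], rule allI)
    fix y show "y \<bullet> x = y \<bullet> (\<Sum>j\<in>UNIV. (x \<bullet> g j) *\<^sub>R g j)"
      using orthonormal_inner[OF assms(3), of y x]
      by (simp add: inner_sum_right inner_commute mult.commute)
  qed
  have "(\<Sum>i\<in>UNIV. f i \<bullet> T (f i)) = (\<Sum>i\<in>UNIV. f i \<bullet> T (\<Sum>j\<in>UNIV. (f i \<bullet> g j) *\<^sub>R g j))"
    using rep by simp
  also have "\<dots> = (\<Sum>i\<in>UNIV. \<Sum>j\<in>UNIV. (g j \<bullet> f i) * (f i \<bullet> T (g j)))"
    by (simp add: linear_sum[OF assms(1)] linear_cmul[OF assms(1)] inner_sum_right inner_commute)
  also have "\<dots> = (\<Sum>j\<in>UNIV. g j \<bullet> T (g j))"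
    by (subst sum.swap) (simp add: orthonormal_inner[OF assms(2)])
  finally show ?thesis .
qed

lemma orthonormal_extend:
  fixes n e :: "real^3"
  assumes "norm n = 1" "norm e = 1" "e \<bullet> n = 0"
  shows "orthonormal (\<lambda>i. if i = 1 then e else if i = 2 then cross3 n e else n)"
  unfolding orthonormal_def
proof (intro allI)
  fix i j :: 3
  have "e \<bullet> e = 1" "n \<bullet> n = 1" using assms by (simp_all add: norm_eq_1)
  then have "(cross3 n e) \<bullet> (cross3 n e) = 1"
    using assms(3) by (simp add: dot_cross inner_commute)
  then show "(if i = 1 then e else if i = 2 then cross3 n e else n) \<bullet> (if j = 1 then e else if j = 2 then cross3 n e else n)
      = (if i = j then 1 else 0)"
    using exhaust_3[of i] exhaust_3[of j] assms(3) \<open>e \<bullet> e = 1\<close> \<open>n \<bullet> n = 1\<close>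
    by (auto simp: dot_cross_self inner_commute)
qed

lemma orthonormal_plane:
  assumes "norm p = 1" "norm e = 1" "e \<bullet> p = 0" "v \<bullet> p = 0"
  shows "v = (v \<bullet> e) *\<^sub>R e + (v \<bullet> cross3 p e) *\<^sub>R cross3 p e"
proof (rule vector_eq_ldot[THEN iffD1], rule allI)
  fix y
  show "y \<bullet> v = y \<bullet> ((v \<bullet> e) *\<^sub>R e + (v \<bullet> cross3 p e) *\<^sub>R cross3 p e)"
    using orthonormal_inner[OF orthonormal_extend[OF assms(1-3)], of y v] assms(4)
    by (simp add: sum_3 inner_commute inner_add_right mult.commute)
qed

text \<open>Cramer's rule for the matrix with columns c1, c2, c3, whose determinant is the triple
  product. The closed formula shows that the inverse depends smoothly on the entries.\<close>

definition inverse3 :: "real^3 \<Rightarrow> real^3 \<Rightarrow> real^3 \<Rightarrow> real^3 \<Rightarrow> real^3" where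
  "inverse3 c1 c2 c3 w = inverse (c1 \<bullet> cross3 c2 c3) *\<^sub>R
    ((cross3 c2 c3 \<bullet> w) *\<^sub>R axis 1 1 + (cross3 c3 c1 \<bullet> w) *\<^sub>R axis 2 1 + (cross3 c1 c2 \<bullet> w) *\<^sub>R axis 3 1)"

lemma inverse3:
  fixes J :: "real^3 \<Rightarrow> real^3"
  assumes J: "linear J" "inj J"
  shows "J (inverse3 (J (axis 1 1)) (J (axis 2 1)) (J (axis 3 1)) w) = w"
    and "J (axis 1 1) \<bullet> cross3 (J (axis 2 1)) (J (axis 3 1)) \<noteq> 0"
proof -
  define c1 c2 c3 where "c1 = J (axis 1 1)" and "c2 = J (axis 2 1)" and "c3 = J (axis 3 1)"
  have "det (matrix J) = c1 \<bullet> cross3 c2 c3"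
    by (simp add: det_3 matrix_def c1_def c2_def c3_def cross3_simps)
  then have d: "c1 \<bullet> cross3 c2 c3 \<noteq> 0" using det_nz_iff_inj[OF J(1)] J(2) by simp
  have id: "(cross3 c2 c3 \<bullet> w) *\<^sub>R c1 + (cross3 c3 c1 \<bullet> w) *\<^sub>R c2 + (cross3 c1 c2 \<bullet> w) *\<^sub>R c3
      = (c1 \<bullet> cross3 c2 c3) *\<^sub>R w"
    unfolding vec_eq_iff forall_3 by (simp add: cross3_simps)
  have "J (inverse3 c1 c2 c3 w) = inverse (c1 \<bullet> cross3 c2 c3) *\<^sub>R
      ((cross3 c2 c3 \<bullet> w) *\<^sub>R c1 + (cross3 c3 c1 \<bullet> w) *\<^sub>R c2 + (cross3 c1 c2 \<bullet> w) *\<^sub>R c3)"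
    unfolding inverse3_def linear_cmul[OF J(1)] linear_add[OF J(1)] c1_def[symmetric] c2_def[symmetric] c3_def[symmetric] ..
  also have "\<dots> = w" unfolding id using d by simp
  finally show "J (inverse3 (J (axis 1 1)) (J (axis 2 1)) (J (axis 3 1)) w) = w"
    and "J (axis 1 1) \<bullet> cross3 (J (axis 2 1)) (J (axis 3 1)) \<noteq> 0"
    using d by (simp_all add: c1_def c2_def c3_def)
qed

section \<open>Principal curvatures as reciprocal eigenvalues\<close>

lemma pencil_singular_iff:
  fixes al be ga l :: real
  shows "(\<exists>x y. (x, y) \<noteq> (0, 0) \<and> x = l * (al * x + be * y) \<and> y = l * (be * x + ga * y))
     \<longleftrightarrow> 1 - l * (al + ga) + l\<^sup>2 * (al * ga - be\<^sup>2) = 0"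
proof
  assume "\<exists>x y. (x, y) \<noteq> (0, 0) \<and> x = l * (al * x + be * y) \<and> y = l * (be * x + ga * y)"
  then obtain x y where xy: "(x, y) \<noteq> (0, 0)" "x = l * (al * x + be * y)" "y = l * (be * x + ga * y)" by blast
  let ?d = "1 - l * (al + ga) + l\<^sup>2 * (al * ga - be\<^sup>2)"
  have e: "(1 - l * al) * x = l * be * y" "(1 - l * ga) * y = l * be * x"
    using xy(2,3) by (simp_all add: algebra_simps)
  have "?d * x = (1 - l * ga) * ((1 - l * al) * x) - l * be * (l * be * x)"
    by (simp add: power2_eq_square algebra_simps)
  also have "\<dots> = 0" unfolding e(2)[symmetric] e(1) by (simp add: algebra_simps)
  finally have dx: "?d * x = 0" .
  have "?d * y = (1 - l * al) * ((1 - l * ga) * y) - l * be * (l * be * y)"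
    by (simp add: power2_eq_square algebra_simps)
  also have "\<dots> = 0" unfolding e(1)[symmetric] e(2) by (simp add: algebra_simps)
  finally show "?d = 0" using dx xy(1) by auto
next
  assume d: "1 - l * (al + ga) + l\<^sup>2 * (al * ga - be\<^sup>2) = 0"
  show "\<exists>x y. (x, y) \<noteq> (0, 0) \<and> x = l * (al * x + be * y) \<and> y = l * (be * x + ga * y)"
  proof (cases "l * be = 0 \<and> 1 - l * al = 0")
    case True
    then show ?thesis by (intro exI[of _ 1] exI[of _ 0]) (auto simp: algebra_simps)
  next
    case False
    \<comment> \<open>The witness solves the first equation identically; the second is then the
      vanishing of the determinant.\<close>
    show ?thesis
      by (rule exI[of _ "l * be"], rule exI[of _ "1 - l * al"])
         (use False d in \<open>auto simp: power2_eq_square algebra_simps\<close>)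
  qed
qed

text \<open>For \<open>B = dX \<circ> (d\<nu>)\<^sup>-\<^sup>1\<close> the eigenvalues of \<open>B\<close> orthogonal to \<open>n\<close> are the principal radii and the
  set \<open>P\<close> consists of the principal curvatures.\<close>
lemma reciprocal_eigenvalues:
  fixes B :: "real^3 \<Rightarrow> real^3"
  assumes lin: "linear B" and sym: "\<And>v w. B v \<bullet> w = v \<bullet> B w" and n: "norm n = 1" "B n = 0"
    and ker: "\<And>w. w \<bullet> n = 0 \<Longrightarrow> B w = 0 \<Longrightarrow> w = 0"
    and f: "orthonormal f"
  defines "P \<equiv> {l. \<exists>w. w \<bullet> n = 0 \<and> w \<noteq> 0 \<and> w = l *\<^sub>R B w}"
    and "s \<equiv> \<Sum>i\<in>UNIV. f i \<bullet> B (f i)" and "q \<equiv> \<Sum>i\<in>UNIV. \<Sum>j\<in>UNIV. (f j \<bullet> B (f i))\<^sup>2"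
  obtains k l where "P = {k, l}" "s * (k * l) = k + l" "(s\<^sup>2 - q) * (k * l) = 2"
proof -
  obtain e0 :: "real^3" where "e0 \<noteq> 0" "orthogonal n e0"
    using orthogonal_to_vector_exists[of n] by auto
  then obtain e where e: "norm e = 1" "e \<bullet> n = 0"
    using that[of "sgn e0"] by (simp add: norm_sgn orthogonal_def sgn_div_norm inner_commute)
  define g where "g = (\<lambda>i::3. if i = 1 then e else if i = 2 then cross3 n e else n)"
  have g: "orthonormal g" unfolding g_def by (rule orthonormal_extend[OF n(1) e])
  define al be ga where "al = g 1 \<bullet> B (g 1)" and "be = g 1 \<bullet> B (g 2)" and "ga = g 2 \<bullet> B (g 2)"
  have g3: "g 3 = n" by (simp add: g_def)
  have be': "g 2 \<bullet> B (g 1) = be" unfolding be_def using sym by (metis inner_commute)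
  have nB: "n \<bullet> B w = 0" "B w \<bullet> n = 0" for w using sym[of n w] n(2) by (simp_all add: inner_commute)
  have "s = (\<Sum>i\<in>UNIV. g i \<bullet> B (g i))" unfolding s_def by (rule trace_orthonormal[OF lin f g])
  then have s: "s = al + ga" by (simp add: sum_3 g3 nB al_def ga_def)
  \<comment> \<open>The sum of squares is the trace of the square of \<open>B\<close>, so like
    \<open>s\<close> it is independent of the frame.\<close>
  have sq: "(\<Sum>i\<in>UNIV. \<Sum>j\<in>UNIV. (f j \<bullet> B (f i))\<^sup>2) = (\<Sum>i\<in>UNIV. f i \<bullet> B (B (f i)))"
    if f: "orthonormal f" for f
  proof (intro sum.cong refl)
    fix i
    have "(\<Sum>j\<in>UNIV. (f j \<bullet> B (f i))\<^sup>2) = B (f i) \<bullet> B (f i)"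
      using orthonormal_inner[OF f, of "B (f i)" "B (f i)"] by (simp add: power2_eq_square inner_commute)
    then show "(\<Sum>j\<in>UNIV. (f j \<bullet> B (f i))\<^sup>2) = f i \<bullet> B (B (f i))" by (simp add: sym)
  qed
  have "q = (\<Sum>i\<in>UNIV. g i \<bullet> B (B (g i)))"
    unfolding q_def sq[OF f] using trace_orthonormal[OF linear_compose[OF lin lin] f g] by simp
  also have "\<dots> = (\<Sum>i\<in>UNIV. \<Sum>j\<in>UNIV. (g j \<bullet> B (g i))\<^sup>2)"
    by (rule sq[OF g, symmetric])
  finally have q: "q = al\<^sup>2 + 2 * be\<^sup>2 + ga\<^sup>2"
    by (simp add: sum_3 g3 nB n(2) be' al_def[symmetric] ga_def[symmetric] be_def[symmetric])
  have coord: "w = (w \<bullet> g 1) *\<^sub>R g 1 + (w \<bullet> g 2) *\<^sub>R g 2" if "w \<bullet> n = 0" for w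
    using orthonormal_plane[OF n(1) e that] by (simp add: g_def)
  have gg: "g 1 \<bullet> g 1 = 1" "g 2 \<bullet> g 2 = 1" "g 1 \<bullet> g 2 = 0" "g 2 \<bullet> g 1 = 0" "g 1 \<bullet> n = 0" "g 2 \<bullet> n = 0"
    using g g3[symmetric] unfolding orthonormal_def by auto
  have B1: "B (x *\<^sub>R g 1 + y *\<^sub>R g 2) = (al * x + be * y) *\<^sub>R g 1 + (be * x + ga * y) *\<^sub>R g 2" for x y
    using coord[OF nB(2), of "x *\<^sub>R g 1 + y *\<^sub>R g 2"]
    by (simp add: linear_add[OF lin] linear_cmul[OF lin] inner_add_left inner_commute[of "B _"] be'
        al_def[symmetric] ga_def[symmetric] be_def[symmetric] mult.commute)
  have inj: "x = x' \<and> y = y'" if "x *\<^sub>R g 1 + y *\<^sub>R g 2 = x' *\<^sub>R g 1 + y' *\<^sub>R g 2" for x y x' y'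
    using arg_cong[OF that, of "\<lambda>v. v \<bullet> g 1"] arg_cong[OF that, of "\<lambda>v. v \<bullet> g 2"]
    by (simp add: inner_add_left gg)
  have P: "l \<in> P \<longleftrightarrow> 1 - l * s + l\<^sup>2 * (al * ga - be\<^sup>2) = 0" for l
  proof -
    have "l \<in> P \<longleftrightarrow> (\<exists>x y. (x, y) \<noteq> (0, 0) \<and> x = l * (al * x + be * y) \<and> y = l * (be * x + ga * y))"
    proof
      assume "l \<in> P"
      then obtain w where w: "w \<bullet> n = 0" "w \<noteq> 0" "w = l *\<^sub>R B w" by (auto simp: P_def)
      define x y where "x = w \<bullet> g 1" and "y = w \<bullet> g 2"
      have wxy: "w = x *\<^sub>R g 1 + y *\<^sub>R g 2" unfolding x_def y_def by (rule coord[OF w(1)])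
      have "x *\<^sub>R g 1 + y *\<^sub>R g 2 = (l * (al * x + be * y)) *\<^sub>R g 1 + (l * (be * x + ga * y)) *\<^sub>R g 2"
        using w(3) unfolding wxy B1 by (simp add: scaleR_add_right)
      then show "\<exists>x y. (x, y) \<noteq> (0, 0) \<and> x = l * (al * x + be * y) \<and> y = l * (be * x + ga * y)"
        using inj w(2) wxy by (intro exI[of _ x] exI[of _ y]) auto
    next
      assume "\<exists>x y. (x, y) \<noteq> (0, 0) \<and> x = l * (al * x + be * y) \<and> y = l * (be * x + ga * y)"
      then obtain x y where xy: "(x, y) \<noteq> (0, 0)" "x = l * (al * x + be * y)" "y = l * (be * x + ga * y)" by blast
      define w where "w = x *\<^sub>R g 1 + y *\<^sub>R g 2"
      have "w = l *\<^sub>R B w"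
        unfolding w_def B1 scaleR_add_right scaleR_scaleR using xy(2,3) by simp
      moreover have "w \<noteq> 0" using inj[of x y 0 0] xy(1) by (auto simp: w_def)
      moreover have "w \<bullet> n = 0" by (simp add: w_def inner_add_left gg)
      ultimately show "l \<in> P" by (auto simp: P_def)
    qed
    then show ?thesis unfolding s pencil_singular_iff .
  qed
  define si where "si = al * ga - be\<^sup>2"
  have "si \<noteq> 0"
  proof
    assume si0: "si = 0"
    have K: "(x, y) = (0, 0)" if "al * x + be * y = 0" "be * x + ga * y = 0" for x y
    proof -
      have "B (x *\<^sub>R g 1 + y *\<^sub>R g 2) = 0" using that by (simp add: B1)
      then have "x *\<^sub>R g 1 + y *\<^sub>R g 2 = 0" by (rule ker[rotated]) (simp_all add: inner_add_left gg)
      then show ?thesis using inj[of x y 0 0] by simp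
    qed
    have "al * ga = be * be" using si0 by (simp add: si_def power2_eq_square)
    \<comment> \<open>In the frame \<open>g\<close>, a singular \<open>B\<close> annihilates (be,
      -al) and (ga, -be), so all entries vanish, and then it annihilates (1, 0).\<close>
    then show False using K[of be "- al"] K[of ga "- be"] K[of 1 0] by (simp add: algebra_simps)
  qed
  have disc: "s\<^sup>2 - 4 * si \<ge> 0"
  proof -
    have "s\<^sup>2 - 4 * si = (al - ga)\<^sup>2 + 4 * be\<^sup>2" by (simp add: s si_def power2_eq_square algebra_simps)
    then show ?thesis by simp
  qed
  \<comment> \<open>The roots, possibly equal, of the quadratic equation that characterises
    \<open>P\<close>; they are real by \<open>disc\<close>.\<close>
  define r k l where "r = sqrt (s\<^sup>2 - 4 * si)" and "k = (s + r) / (2 * si)" and "l = (s - r) / (2 * si)"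
  have r2: "r * r = s\<^sup>2 - 4 * si" using disc by (simp add: r_def)
  have sum: "k + l = s / si" and prod: "k * l = 1 / si"
  proof -
    show "k + l = s / si" by (simp add: k_def l_def add_divide_distrib[symmetric])
    have "(s + r) * (s - r) = 4 * si" using r2 by (simp add: power2_eq_square algebra_simps)
    then show "k * l = 1 / si" using \<open>si \<noteq> 0\<close> by (simp add: k_def l_def)
  qed
  have "1 - m * s + m\<^sup>2 * si = si * ((m - k) * (m - l))" for m
  proof -
    have "si * ((m - k) * (m - l)) = m\<^sup>2 * si - m * (si * (k + l)) + si * (k * l)"
      by (simp add: power2_eq_square algebra_simps)
    then show ?thesis using \<open>si \<noteq> 0\<close> unfolding sum prod by simp
  qed
  then have "P = {k, l}" using P \<open>si \<noteq> 0\<close> by (auto simp: si_def[symmetric])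
  moreover have "s * (k * l) = k + l" unfolding sum prod by simp
  moreover have "s\<^sup>2 - q = 2 * si" by (simp add: s q si_def power2_eq_square algebra_simps)
  then have "(s\<^sup>2 - q) * (k * l) = 2" using \<open>si \<noteq> 0\<close> by (simp add: prod)
  ultimately show thesis by (rule that)
qed

section \<open>Derivatives along the sphere\<close>

text \<open>The sphere has no interior, so a derivative within it is determined on tangent vectors
  only; composition with the great circle through \<open>p\<close> in direction \<open>v\<close>
  shows that there it is.\<close>

lemma sphere_derivative_unique:
  fixes g :: "real^3 \<Rightarrow> 'b::real_normed_vector"
  assumes p: "p \<in> S2" and v: "v \<bullet> p = 0"
    and g1: "(g has_derivative g1) (at p within S2)" and g2: "(g has_derivative g2) (at p within S2)"
  shows "g1 v = g2 v"
proof (cases "v = 0")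
  case True
  then show ?thesis using g1 g2 has_derivative_linear linear_0 by metis
next
  case False
  define w where "w = v /\<^sub>R norm v"
  have w: "norm w = 1" "w \<bullet> p = 0" "v = norm v *\<^sub>R w" using False v by (auto simp: w_def)
  define c where "c = (\<lambda>r. cos r *\<^sub>R p + sin r *\<^sub>R w)"
  have c: "(c has_derivative (\<lambda>h. h *\<^sub>R w)) (at 0)"
    unfolding c_def by (auto intro!: derivative_eq_intros)
  have pp: "p \<bullet> p = 1" "w \<bullet> w = 1" using p w(1) by (simp_all add: S2_def norm_eq_1)
  have "c r \<in> S2" for r
  proof -
    have "c r \<bullet> c r = (cos r)\<^sup>2 + (sin r)\<^sup>2"
      using w(2) pp by (simp add: c_def inner_add_left inner_add_right inner_commute[of p w] power2_eq_square)
    then show ?thesis by (simp add: S2_def norm_eq_1)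
  qed
  then have r: "range c \<subseteq> S2" by blast
  have c0: "c 0 = p" by (simp add: c_def)
  have D: "((\<lambda>r. g (c r)) has_derivative (\<lambda>h. G (h *\<^sub>R w))) (at 0)"
    if "(g has_derivative G) (at p within S2)" for G
    by (rule has_derivative_in_compose[OF c]) (rule has_derivative_subset[OF _ r], simp add: c0 that)
  have "(\<lambda>h. g1 (h *\<^sub>R w)) = (\<lambda>h. g2 (h *\<^sub>R w))"
    by (rule has_derivative_unique[OF D[OF g1] D[OF g2]])
  then show ?thesis using w(3) by metis
qed

lemma frechet_derivative_sphere:
  fixes g :: "real^3 \<Rightarrow> 'b::real_normed_vector"
  assumes "F differentiable (at p)" "\<And>q. q \<in> S2 \<Longrightarrow> F q = g q" "p \<in> S2" "v \<bullet> p = 0"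
  shows "frechet_derivative g (at p within S2) v = dd v F p"
proof -
  have "(F has_derivative (\<lambda>v. dd v F p)) (at p within S2)"
    using has_derivative_dd[OF assms(1)] has_derivative_at_withinI by blast
  then have 1: "(g has_derivative (\<lambda>v. dd v F p)) (at p within S2)"
    using has_derivative_transform[OF assms(3), of g F] assms(2) by metis
  then have "(g has_derivative frechet_derivative g (at p within S2)) (at p within S2)"
    using frechet_derivative_works differentiable_def by blast
  then show ?thesis by (rule sphere_derivative_unique[OF assms(3,4) _ 1])
qed

section \<open>Existence of the outer normal\<close>

text \<open>The derivative is continuous in operator norm because its partial derivatives are:
  \<open>S\<close> adds up their changes and bounds the norm of the change of the
  derivative.\<close>

lemma smooth_locally_injective:
  fixes f :: "'a::euclidean_space \<Rightarrow> 'a"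
  assumes f: "smooth_on UNIV f" and inj: "inj (\<lambda>v. dd v f a)"
  obtains r where "r > 0" "inj_on f (ball a r)"
proof -
  have D: "(f has_derivative (\<lambda>v. dd v f x)) (at x)" for x
    using smooth_on_has_derivative[OF open_UNIV f] by simp
  have lin: "linear (\<lambda>v. dd v f x)" for x
    using D has_derivative_linear by blast
  obtain g' where g': "linear g'" "g' \<circ> (\<lambda>v. dd v f a) = id"
    using linear_injective_left_inverse[OF lin inj] by blast
  define S where "S x = (\<Sum>i\<in>Basis. norm (dd i f x - dd i f a))" for x
  have "continuous_on UNIV S"
    unfolding S_def by (intro continuous_intros smooth_on_continuous smooth_on_dd f open_UNIV)
  have on: "onorm (\<lambda>v. dd v f x - dd v f a) \<le> S x" for x
  proof (rule onorm_bound)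
    show "0 \<le> S x" by (simp add: S_def sum_nonneg)
    fix v
    have "linear (\<lambda>v. dd v f x - dd v f a)" using linear_compose_sub[OF lin lin] .
    then have "dd v f x - dd v f a = (\<Sum>i\<in>Basis. (v \<bullet> i) *\<^sub>R (dd i f x - dd i f a))"
      using linear_sum[of "\<lambda>v. dd v f x - dd v f a" "\<lambda>i. (v \<bullet> i) *\<^sub>R i" Basis]
      by (simp add: euclidean_representation linear_cmul[of "\<lambda>v. dd v f x - dd v f a"])
    also have "norm \<dots> \<le> (\<Sum>i\<in>Basis. norm v * norm (dd i f x - dd i f a))"
      by (rule sum_norm_le) (simp add: mult_right_mono Basis_le_norm)
    finally show "norm (dd v f x - dd v f a) \<le> S x * norm v"
      by (simp add: S_def sum_distrib_left mult.commute)
  qed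
  have ex: "\<exists>d>0. \<forall>x. dist a x < d \<longrightarrow> onorm (\<lambda>v. dd v f x - dd v f a) < e" if "e > 0" for e
  proof -
    have "isCont S a" using \<open>continuous_on UNIV S\<close> by (simp add: continuous_on_eq_continuous_at)
    moreover have "S a = 0" by (simp add: S_def)
    ultimately obtain d where "d > 0" "\<And>x. dist x a < d \<Longrightarrow> dist (S x) 0 < e"
      using \<open>e > 0\<close> unfolding continuous_at_eps_delta by metis
    then have "\<And>x. dist a x < d \<Longrightarrow> S x < e" by (fastforce simp: dist_commute)
    then show ?thesis using on \<open>d > 0\<close> le_less_trans by blast
  qed
  obtain r where "r > 0" "inj_on f (ball a r)"
    by (rule has_derivative_locally_injective[OF UNIV_I open_UNIV
          linear_conv_bounded_linear[THEN iffD1, OF g'(1)] g'(2) D ex])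
  then show thesis by (rule that)
qed

text \<open>Near \<open>p\<close> the surface is the zero set of the last coordinate in the local homeomorphism
  \<open>\<Phi>\<close>, so it locally has two connected sides; by the Jordan-Brouwer theorem one of them
  meets the outside.\<close>
lemma outer_normal_exists:
  fixes f :: "real^3 \<Rightarrow> real^3"
  assumes f: "smooth_on (- {0}) f" and hom: "\<And>c x. c > 0 \<Longrightarrow> f (c *\<^sub>R x) = f x"
    and inj: "inj_on f S2" and p: "p \<in> S2"
    and imm: "\<And>v. v \<bullet> p = 0 \<Longrightarrow> v \<noteq> 0 \<Longrightarrow> dd v f p \<noteq> 0"
  shows "\<exists>N. norm N = 1 \<and> (\<forall>v. v \<bullet> p = 0 \<longrightarrow> N \<bullet> dd v f p = 0) \<and>
    (\<forall>\<^sub>F s in at_right 0. f p + s *\<^sub>R N \<in> outside (f ` S2))"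
proof -
  have op: "open (- {0 :: real^3})" by auto
  have pp: "p \<bullet> p = 1" "p \<noteq> 0" using p by (auto simp: S2_def norm_eq_1)
  have Df: "(f has_derivative (\<lambda>v. dd v f p)) (at p)"
    using smooth_on_has_derivative[OF op f] pp by simp
  define L where "L = (\<lambda>v. dd v f p)"
  have lin: "linear L" using Df has_derivative_linear L_def by blast
  \<comment> \<open>The image of the tangent plane has dimension at most 2, so some nonzero vector
    is orthogonal to it.\<close>
  have "dim (L ` {v. p \<bullet> v = 0}) \<le> dim {v. p \<bullet> v = 0}" by (rule dim_image_le[OF lin])
  also have "\<dots> < DIM(real^3)" using dim_hyperplane[OF pp(2)] by simp
  finally obtain x where x: "x \<noteq> 0" "\<And>y. y \<in> span (L ` {v. p \<bullet> v = 0}) \<Longrightarrow> orthogonal x y"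
    using orthogonal_to_subspace_exists by blast
  define N where "N = sgn x"
  have N: "norm N = 1" using x by (simp add: N_def norm_sgn)
  have NL: "N \<bullet> L v = 0" if "v \<bullet> p = 0" for v
    using x(2)[OF span_base, of "L v"] that by (auto simp: N_def sgn_div_norm orthogonal_def inner_commute)
  \<comment> \<open>\<open>ta\<close> projects orthogonally to the affine plane tangent to the
    sphere at \<open>p\<close>, which misses the origin; by homogeneity \<open>f\<close> maps this
    plane into the surface. \<open>Ph\<close> adds a displacement along \<open>N\<close> by the
    height above the plane.\<close>
  define ta where "ta y = y - (y \<bullet> p - 1) *\<^sub>R p" for y
  have tap: "ta y \<bullet> p = 1" for y using pp by (simp add: ta_def inner_diff_left)
  then have ta0: "ta y \<noteq> 0" for y by (metis inner_zero_left zero_neq_one)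
  define Ph where "Ph y = f (ta y) + (y \<bullet> p - 1) *\<^sub>R N" for y
  have sm_id: "smooth_on UNIV (\<lambda>y::real^3. y)" by (rule smooth_on_bounded_linear) auto
  have sm_ta: "smooth_on UNIV ta"
    unfolding ta_def by (intro smooth_on_diff smooth_on_scaleR smooth_on_inner smooth_on_const sm_id open_UNIV)
  have sm_Ph: "smooth_on UNIV Ph"
    unfolding Ph_def
    by (intro smooth_on_add smooth_on_diff smooth_on_scaleR smooth_on_inner smooth_on_const sm_id open_UNIV
        smooth_on_compose[OF open_UNIV op _ f sm_ta]) (use ta0 in auto)
  have dta: "(ta has_derivative (\<lambda>v. v - (v \<bullet> p) *\<^sub>R p)) (at p)"
    unfolding ta_def by (auto intro!: derivative_eq_intros)
  have "ta p = p" using pp by (simp add: ta_def)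
  then have "((\<lambda>y. f (ta y)) has_derivative (\<lambda>v. L (v - (v \<bullet> p) *\<^sub>R p))) (at p)"
    unfolding L_def using has_derivative_compose[OF dta, of f "\<lambda>v. dd v f p"] Df by simp
  then have DPh: "(Ph has_derivative (\<lambda>v. L (v - (v \<bullet> p) *\<^sub>R p) + (v \<bullet> p) *\<^sub>R N)) (at p)"
    unfolding Ph_def by (auto intro!: derivative_eq_intros)
  have dPh: "dd v Ph p = L (v - (v \<bullet> p) *\<^sub>R p) + (v \<bullet> p) *\<^sub>R N" for v
    by (rule dd_eqI[OF DPh])
  have "linear (\<lambda>v. dd v Ph p)" using dd_linear[OF open_UNIV sm_Ph] by simp
  then have "inj (\<lambda>v. dd v Ph p)"
  proof (rule linear_injective_0[THEN iffD2], intro allI impI)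
    fix v assume v: "dd v Ph p = 0"
    have t: "(v - (v \<bullet> p) *\<^sub>R p) \<bullet> p = 0" using pp by (simp add: inner_diff_left)
    have "N \<bullet> (L (v - (v \<bullet> p) *\<^sub>R p) + (v \<bullet> p) *\<^sub>R N) = v \<bullet> p"
      using NL[OF t] N by (simp add: inner_add_right norm_eq_1)
    then have vp: "v \<bullet> p = 0" using v dPh by simp
    then have "L v = 0" using v dPh by simp
    then show "v = 0" using imm[OF vp] by (auto simp: L_def)
  qed
  then obtain r where r: "r > 0" "inj_on Ph (ball p r)"
    using smooth_locally_injective[OF sm_Ph] by blast
  have contPh: "continuous_on A Ph" for A
    using smooth_on_continuous[OF sm_Ph] continuous_on_subset by blast
  have Phta: "Ph y = f y" if "y \<bullet> p = 1" for y using that by (simp add: Ph_def ta_def)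
  have contf: "continuous_on S2 f"
    using smooth_on_continuous[OF f] by (rule continuous_on_subset) (auto simp: S2_def)
  have "\<exists>r'>0. \<forall>q. dist q p < r' \<longrightarrow> q \<bullet> p > 0 \<and> q /\<^sub>R (q \<bullet> p) \<in> ball p r"
  proof -
    have c1: "isCont (\<lambda>q. q \<bullet> p) p" by (intro continuous_intros)
    have c2: "isCont (\<lambda>q. q /\<^sub>R (q \<bullet> p)) p" using pp by (intro continuous_intros) auto
    obtain d1 where d1: "d1 > 0" "\<And>q. dist q p < d1 \<Longrightarrow> dist (q \<bullet> p) (p \<bullet> p) < 1"
      using c1 unfolding continuous_at_eps_delta by (meson zero_less_one)
    obtain d2 where d2: "d2 > 0" "\<And>q. dist q p < d2 \<Longrightarrow> dist (q /\<^sub>R (q \<bullet> p)) (p /\<^sub>R (p \<bullet> p)) < r"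
      using c2 r(1) unfolding continuous_at_eps_delta by meson
    have "q \<bullet> p > 0" if "dist q p < d1" for q
      using d1(2)[OF that] pp by (simp add: dist_real_def)
    moreover have "q /\<^sub>R (q \<bullet> p) \<in> ball p r" if "dist q p < d2" for q
      using d2(2)[OF that] pp by (simp add: dist_commute)
    ultimately show ?thesis using d1(1) d2(1) by (intro exI[of _ "min d1 d2"]) auto
  qed
  then obtain r' where r': "r' > 0" "\<And>q. dist q p < r' \<Longrightarrow> q \<bullet> p > 0 \<and> q /\<^sub>R (q \<bullet> p) \<in> ball p r"
    by blast
  have cS2: "compact S2" by (simp add: S2_def)
  \<comment> \<open>The part of the surface away from \<open>f p\<close> is compact and, by
    injectivity, does not contain \<open>f p\<close>; a small ball around \<open>p\<close> is
    therefore mapped off it.\<close>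
  define C where "C = f ` (S2 - ball p r')"
  have "compact C"
    unfolding C_def by (intro compact_continuous_image continuous_on_subset[OF contf] compact_diff cS2) auto
  have "f p \<notin> C" using inj p r'(1) by (auto simp: C_def inj_on_def)
  have "open (Ph -` (- C))"
    using continuous_open_vimage[of "- C" Ph] contPh[of UNIV] \<open>compact C\<close>
    by (simp add: compact_imp_closed open_Compl continuous_on_eq_continuous_at)
  moreover have "p \<in> Ph -` (- C)" using \<open>f p \<notin> C\<close> Phta pp by simp
  ultimately obtain e where e: "e > 0" "ball p e \<subseteq> Ph -` (- C)" using openE by blast
  define r2 where "r2 = min r e"
  have r2: "r2 > 0" "r2 \<le> r" "ball p r2 \<subseteq> Ph -` (- C)" using r e by (auto simp: r2_def)
  \<comment> \<open>A surface point near \<open>f p\<close> is the image of a point of the plane,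
    the central projection of its parameter, so injectivity of \<open>Ph\<close> excludes points off
    the plane.\<close>
  have off: "Ph y \<notin> f ` S2" if y: "y \<in> ball p r2" "y \<bullet> p \<noteq> 1" for y
  proof
    assume "Ph y \<in> f ` S2"
    then obtain q where q: "q \<in> S2" "Ph y = f q" by blast
    have "q \<in> ball p r'"
    proof (rule ccontr)
      assume "q \<notin> ball p r'"
      then have "Ph y \<in> C" using q by (auto simp: C_def)
      then show False using y(1) r2(3) by auto
    qed
    then have q': "q \<bullet> p > 0" "q /\<^sub>R (q \<bullet> p) \<in> ball p r" using r'(2)[of q] by (auto simp: dist_commute)
    have "Ph (q /\<^sub>R (q \<bullet> p)) = f q" using q'(1) hom[of "inverse (q \<bullet> p)" q] Phta by simp
    moreover have "y \<in> ball p r" using y(1) r2(2) by auto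
    ultimately have "y = q /\<^sub>R (q \<bullet> p)" using r(2) q' q(2) by (metis inj_onD)
    then show False using y(2) q'(1) by simp
  qed
  define S where "S = f ` S2"
  have "compact S" unfolding S_def by (rule compact_continuous_image[OF contf cS2])
  have "S2 homeomorphic S" by (rule homeomorphic_compact[OF cS2 contf _ inj]) (simp add: S_def)
  then have "S homeomorphic sphere (0::real^3) 1"
    unfolding S2_def by (rule homeomorphic_sym[THEN iffD1])
  \<comment> \<open>By Jordan-Brouwer the frontier of such a component is all of \<open>S\<close>,
    so the outside comes arbitrarily close to \<open>f p\<close>.\<close>
  moreover have "outside S \<in> components (- S)"
    unfolding outside_in_components
    using connected_outside[of S] compact_imp_bounded[OF \<open>compact S\<close>] unbounded_outside[of S] by force
  ultimately have "frontier (outside S) = S" by (rule Jordan_Brouwer_frontier) simp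
  moreover have "f p \<in> S" using p by (simp add: S_def)
  ultimately have "f p \<in> closure (outside S)" by (auto simp: frontier_def)
  moreover have "open (Ph ` ball p r2)"
    by (rule invariance_of_domain[OF contPh open_ball]) (rule inj_on_subset[OF r(2)], use r2 in auto)
  moreover have "f p \<in> Ph ` ball p r2" using Phta[OF pp(1)] r2(1) by (metis centre_in_ball imageI)
  ultimately obtain y where y: "y \<in> ball p r2" "Ph y \<in> outside S"
    using open_Int_closure_eq_empty[of "Ph ` ball p r2" "outside S"] by blast
  have "y \<bullet> p \<noteq> 1"
  proof
    assume y1: "y \<bullet> p = 1"
    then have "y \<noteq> 0" by auto
    then have "f y \<in> S" using hom[of "inverse (norm y)" y] unfolding S_def
      by (intro image_eqI[of _ _ "y /\<^sub>R norm y"]) (auto simp: S2_def)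
    then show False using y(2) Phta[OF y1] outside_no_overlap[of S] by (metis IntI empty_iff)
  qed
  \<comment> \<open>To be used for the two open halves of the ball: their images are connected and
    avoid the surface, so one outside point puts the whole half outside.\<close>
  have side: "Ph ` H \<subseteq> outside S" if H: "convex H" "y \<in> H" "H \<subseteq> ball p r2" "\<And>z. z \<in> H \<Longrightarrow> z \<bullet> p \<noteq> 1" for H
  proof -
    have "connected (Ph ` H)" by (rule connected_continuous_image[OF contPh convex_connected[OF H(1)]])
    moreover have "Ph z \<notin> S" if "z \<in> H" for z
      using off[of z] H(3) H(4)[OF that] that unfolding S_def by (metis subsetD)
    then have "Ph ` H \<subseteq> - S" by (simp add: image_subset_iff)
    ultimately have "connected_component (- S) (Ph y) (Ph z)" if "z \<in> H" for z
      unfolding connected_component_def using that H(2) by (intro exI[of _ "Ph ` H"]) simp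
    then show ?thesis using outside_same_component[OF _ y(2)] by (simp add: image_subset_iff)
  qed
  have line: "Ph (p + c *\<^sub>R p) = f p + c *\<^sub>R N" "p + c *\<^sub>R p \<in> ball p r2 \<longleftrightarrow> \<bar>c\<bar> < r2"
      "(p + c *\<^sub>R p) \<bullet> p = 1 + c" for c
    using pp p by (simp_all add: Ph_def ta_def inner_add_left S2_def dist_norm algebra_simps)
  have ev: "\<forall>\<^sub>F s in at_right 0. 0 < s \<and> s < r2"
    using r2(1) by (auto simp: eventually_at_right_field)
  show ?thesis
  proof (cases "y \<bullet> p > 1")
    case True
    have "convex (ball p r2 \<inter> {z. p \<bullet> z > 1})" by (intro convex_Int convex_ball convex_halfspace_gt)
    then have "Ph ` (ball p r2 \<inter> {z. p \<bullet> z > 1}) \<subseteq> outside S"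
      by (rule side) (use True y in \<open>auto simp: inner_commute\<close>)
    moreover have "p + s *\<^sub>R p \<in> ball p r2 \<inter> {z. p \<bullet> z > 1}" if "0 < s \<and> s < r2" for s
      using line[of s] that by (simp add: inner_commute)
    ultimately have "f p + s *\<^sub>R N \<in> outside S" if "0 < s \<and> s < r2" for s
      using line(1)[of s] that by (metis image_subset_iff)
    then show ?thesis using N NL ev unfolding S_def L_def
      by (intro exI[of _ N]) (auto elim: eventually_mono)
  next
    case False
    have "convex (ball p r2 \<inter> {z. p \<bullet> z < 1})" by (intro convex_Int convex_ball convex_halfspace_lt)
    then have *: "Ph ` (ball p r2 \<inter> {z. p \<bullet> z < 1}) \<subseteq> outside S"
      by (rule side) (use False \<open>y \<bullet> p \<noteq> 1\<close> y in \<open>auto simp: inner_commute\<close>)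
    have "f p + s *\<^sub>R (- N) \<in> outside S" if "0 < s \<and> s < r2" for s
    proof -
      have "p + (- s) *\<^sub>R p \<in> ball p r2 \<inter> {z. p \<bullet> z < 1}" 
        using line[of "- s"] that by (simp add: inner_commute)
      then have "Ph (p + (- s) *\<^sub>R p) \<in> outside S" using * by blast
      then show ?thesis using line(1)[of "- s"] by simp
    qed
    then show ?thesis using N NL ev unfolding S_def L_def
      by (intro exI[of _ "- N"]) (auto elim: eventually_mono)
  qed
qed

section \<open>The Gauss map along the flow\<close>

locale inverse_curvature_flow =
  fixes X :: "real^3 \<Rightarrow> real \<Rightarrow> real^3" and a b :: real and U :: "((real^3) \<times> real) set"
  assumes U: "open U" "S2 \<times> {a<..<b} \<subseteq> U" "smooth_on U (\<lambda>z. X (fst z) (snd z))"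
    and embedded: "t \<in> {a<..<b} \<Longrightarrow> embedded_surface X t"
    and convex: "t \<in> {a<..<b} \<Longrightarrow> strictly_convex X t"
    and flow: "t \<in> {a<..<b} \<Longrightarrow> p \<in> S2 \<Longrightarrow> ((\<lambda>s. X p s) has_vector_derivative
           ((mean_curv X t p)\<^sup>2 / (gauss_curv X t p)\<^sup>2) *\<^sub>R outer_normal X t p) (at t)"
begin

definition D :: "((real^3) \<times> real) set" where "D = (- {0}) \<times> {a<..<b}"

text \<open>\<open>X\<close> extended with degree 0 to an open domain, where ordinary derivatives
  are available.\<close>

definition Y :: "(real^3) \<times> real \<Rightarrow> real^3" where "Y z = X (sgn (fst z)) (snd z)"

lemma open_D: "open D" unfolding D_def by (intro open_Times) auto

lemma D_iff: "(x, t) \<in> D \<longleftrightarrow> x \<noteq> 0 \<and> a < t \<and> t < b" by (auto simp: D_def)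

lemma S2_iff: "p \<in> S2 \<longleftrightarrow> norm p = 1" by (simp add: S2_def)

lemma sgn_S2: "x \<noteq> 0 \<Longrightarrow> sgn x \<in> S2" by (simp add: S2_iff norm_sgn)

lemma sgn_id: "p \<in> S2 \<Longrightarrow> sgn p = p" by (simp add: S2_iff sgn_div_norm)

lemma S2_D: "p \<in> S2 \<Longrightarrow> t \<in> {a<..<b} \<Longrightarrow> (p, t) \<in> D" by (auto simp: D_iff S2_iff)

lemma smooth_fst: "smooth_on D fst" and smooth_snd: "smooth_on D snd"
  by (intro smooth_on_bounded_linear open_D bounded_linear_fst bounded_linear_snd)+

lemma smooth_norm: "smooth_on D (\<lambda>z. norm (fst z))"
  by (rule smooth_on_norm[OF open_D _ smooth_fst]) (auto simp: D_def)

lemma smooth_Y: "smooth_on D Y"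
proof -
  have sgn: "smooth_on D (\<lambda>z. sgn (fst z))"
    unfolding sgn_div_norm
    by (intro smooth_on_scaleR smooth_on_inverse smooth_norm smooth_fst open_D) (auto simp: D_def)
  have g: "smooth_on D (\<lambda>z. (sgn (fst z), snd z))"
    by (rule smooth_on_Pair[OF open_D sgn smooth_snd])
  have "smooth_on D (\<lambda>z. X (fst (sgn (fst z), snd z)) (snd (sgn (fst z), snd z)))"
    by (rule smooth_on_compose[OF open_D U(1) _ U(3) g]) (auto simp: D_def intro!: subsetD[OF U(2)] sgn_S2)
  then show ?thesis by (simp add: Y_def[abs_def])
qed

lemma Y_hom: "c > 0 \<Longrightarrow> Y (c *\<^sub>R x, t) = Y (x, t)"
  by (simp add: Y_def sgn_scaleR)

lemma Y_sgn: "Y (x, t) = X (sgn x) t" by (simp add: Y_def)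

lemma Y_S2: "p \<in> S2 \<Longrightarrow> Y (p, t) = X p t" by (simp add: Y_def sgn_id)

text \<open>The chain rule for scaling the space variable by \<open>c\<close>. The factor
  \<open>d\<close> is 1 for \<open>Y\<close> and \<open>c\<close> for \<open>nu\<close>.\<close>

lemma dd_homogeneous:
  fixes f :: "(real^3) \<times> real \<Rightarrow> 'c::real_normed_vector"
  assumes f: "smooth_on D f" and c: "c > 0" and xt: "(x, t) \<in> D"
    and hom: "\<And>x s. (x, s) \<in> D \<Longrightarrow> f (c *\<^sub>R x, s) = d *\<^sub>R f (x, s)"
  shows "dd (c *\<^sub>R v, r) f (c *\<^sub>R x, t) = d *\<^sub>R dd (v, r) f (x, t)"
proof -
  define A where "A z = (c *\<^sub>R fst z, snd z)" for z :: "(real^3) \<times> real"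
  have A: "(A has_derivative A) (at (x, t))"
    unfolding A_def by (auto intro!: derivative_eq_intros)
  have "A (x, t) \<in> D" using xt c by (simp add: A_def D_iff)
  then have "((\<lambda>z. f (A z)) has_derivative (\<lambda>v. dd (A v) f (A (x, t)))) (at (x, t))"
    by (intro has_derivative_compose[OF A] smooth_on_has_derivative[OF open_D f])
  moreover have "((\<lambda>z. d *\<^sub>R f z) has_derivative (\<lambda>v. d *\<^sub>R dd v f (x, t))) (at (x, t))"
    by (intro has_derivative_scaleR_right smooth_on_has_derivative[OF open_D f xt])
  then have "((\<lambda>z. f (A z)) has_derivative (\<lambda>v. d *\<^sub>R dd v f (x, t))) (at (x, t))"
    by (rule has_derivative_transform_within_open[OF _ open_D xt]) (use hom in \<open>force simp: A_def\<close>)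
  ultimately have "(\<lambda>v. dd (A v) f (A (x, t))) = (\<lambda>v. d *\<^sub>R dd v f (x, t))"
    by (rule has_derivative_unique)
  from fun_cong[OF this, of "(v, r)"] show ?thesis by (simp add: A_def)
qed

lemma slice_has_derivative:
  assumes "smooth_on D f" "(x, t) \<in> D"
  shows "((\<lambda>x. f (x, t)) has_derivative (\<lambda>v. dd (v, 0) f (x, t))) (at x)"
proof -
  have "((\<lambda>x. (x, t)) has_derivative (\<lambda>v. (v, 0))) (at x)"
    by (auto intro!: derivative_eq_intros)
  then show ?thesis
    by (rule has_derivative_compose) (rule smooth_on_has_derivative[OF open_D assms])
qed

lemma slice_dd:
  assumes "smooth_on D f" "(x, t) \<in> D"
  shows "dd v (\<lambda>x. f (x, t)) x = dd (v, 0) f (x, t)"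
  using slice_has_derivative[OF assms] by (rule dd_eqI)

lemma slice_linear: "smooth_on D f \<Longrightarrow> z \<in> D \<Longrightarrow> linear (\<lambda>v. dd (v, 0) f z)"
  using slice_has_derivative[of f "fst z" "snd z"] has_derivative_linear by auto

lemma frechet_slice:
  assumes "smooth_on D F" "t \<in> {a<..<b}" "\<And>q. q \<in> S2 \<Longrightarrow> F (q, t) = g q" "p \<in> S2" "v \<bullet> p = 0"
  shows "frechet_derivative g (at p within S2) v = dd (v, 0) F (p, t)"
proof -
  have pt: "(p, t) \<in> D" by (rule S2_D[OF assms(4,2)])
  have "(\<lambda>x. F (x, t)) differentiable (at p)"
    using slice_has_derivative[OF assms(1) pt] differentiable_def by blast
  then show ?thesis
    using frechet_derivative_sphere[of "\<lambda>x. F (x, t)" p g v] assms slice_dd[OF assms(1) pt] by simp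
qed

lemma dX_eq:
  assumes "t \<in> {a<..<b}" "p \<in> S2" "v \<bullet> p = 0"
  shows "dX X t p v = dd (v, 0) Y (p, t)"
  unfolding dX_def by (rule frechet_slice[OF smooth_Y assms(1) _ assms(2,3)]) (rule Y_S2)

lemma dd_Y_nonzero:
  assumes "t \<in> {a<..<b}" "p \<in> S2" "v \<bullet> p = 0" "v \<noteq> 0"
  shows "dd (v, 0) Y (p, t) \<noteq> 0"
  using embedded[OF assms(1)] assms dX_eq unfolding embedded_surface_def by metis

text \<open>The chosen vector has the properties it was chosen for only because such a vector
  exists, which is \<open>outer_normal_exists\<close> for the slice of \<open>Y\<close> at time
  \<open>t\<close>.\<close>

lemma outer_normal_spec:
  assumes t: "t \<in> {a<..<b}" and p: "p \<in> S2"
  shows "norm (outer_normal X t p) = 1" "v \<bullet> p = 0 \<Longrightarrow> outer_normal X t p \<bullet> dd (v, 0) Y (p, t) = 0"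
proof -
  have sm: "smooth_on (- {0}) (\<lambda>x. Y (x, t))"
  proof (rule smooth_on_compose[of _ D, OF _ open_D _ smooth_Y])
    show "smooth_on (- {0}) (\<lambda>x::real^3. (x, t))"
      by (intro smooth_on_Pair smooth_on_const smooth_on_bounded_linear) auto
  qed (use t in \<open>auto simp: D_iff\<close>)
  have "\<exists>N. norm N = 1 \<and> (\<forall>v. v \<bullet> p = 0 \<longrightarrow> N \<bullet> dd v (\<lambda>x. Y (x, t)) p = 0) \<and>
    (\<forall>\<^sub>F s in at_right 0. Y (p, t) + s *\<^sub>R N \<in> outside ((\<lambda>x. Y (x, t)) ` S2))"
  proof (rule outer_normal_exists[OF sm Y_hom _ p])
    show "inj_on (\<lambda>x. Y (x, t)) S2"
      using embedded[OF t] unfolding embedded_surface_def by (simp add: inj_on_def Y_S2)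
    show "dd v (\<lambda>x. Y (x, t)) p \<noteq> 0" if "v \<bullet> p = 0" "v \<noteq> 0" for v
      using dd_Y_nonzero[OF t p that] slice_dd[OF smooth_Y S2_D[OF p t]] by simp
  qed
  moreover have "surf X t = (\<lambda>x. Y (x, t)) ` S2"
    unfolding surf_def by (intro image_cong) (simp_all add: Y_S2)
  ultimately have "\<exists>N. norm N = 1 \<and> (\<forall>v. v \<bullet> p = 0 \<longrightarrow> N \<bullet> dX X t p v = 0) \<and>
      (\<forall>\<^sub>F s in at_right 0. X p t + s *\<^sub>R N \<in> outside (surf X t))"
    using dX_eq[OF t p] slice_dd[OF smooth_Y S2_D[OF p t]] Y_S2[OF p] by auto
  from someI_ex[OF this, folded outer_normal_def]
  show "norm (outer_normal X t p) = 1" "v \<bullet> p = 0 \<Longrightarrow> outer_normal X t p \<bullet> dd (v, 0) Y (p, t) = 0"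
    using dX_eq[OF t p] by auto
qed

section \<open>The Gauss map recovered from the velocity\<close>

definition Yt :: "(real^3) \<times> real \<Rightarrow> real^3" where "Yt = dd (0, 1) Y"

definition speed :: "real \<Rightarrow> real^3 \<Rightarrow> real" where
  "speed t p = (mean_curv X t p)\<^sup>2 / (gauss_curv X t p)\<^sup>2"

lemma kappa_pos: "t \<in> {a<..<b} \<Longrightarrow> p \<in> S2 \<Longrightarrow> kappa1 X t p > 0 \<and> kappa2 X t p > 0"
  using convex unfolding strictly_convex_def by blast

lemma speed_pos: "t \<in> {a<..<b} \<Longrightarrow> p \<in> S2 \<Longrightarrow> speed t p > 0"
  using kappa_pos[of t p] by (simp add: speed_def mean_curv_def gauss_curv_def)

lemma smooth_Yt: "smooth_on D Yt"
  unfolding Yt_def by (rule smooth_on_dd[OF open_D smooth_Y])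

lemma Yt_eq:
  assumes "(x, t) \<in> D"
  shows "Yt (x, t) = speed t (sgn x) *\<^sub>R outer_normal X t (sgn x)"
proof -
  have t: "t \<in> {a<..<b}" and x: "x \<noteq> 0" using assms by (auto simp: D_iff)
  have "((\<lambda>s. (x, s)) has_derivative (\<lambda>h. (0, h))) (at t)"
    by (auto intro!: derivative_eq_intros)
  then have "((\<lambda>s. Y (x, s)) has_derivative (\<lambda>h. dd (0, h) Y (x, t))) (at t)"
    by (rule has_derivative_compose) (rule smooth_on_has_derivative[OF open_D smooth_Y assms])
  moreover have "((\<lambda>s. Y (x, s)) has_derivative (\<lambda>h. h *\<^sub>R (speed t (sgn x) *\<^sub>R outer_normal X t (sgn x)))) (at t)"
    using flow[OF t sgn_S2[OF x]] unfolding has_vector_derivative_def speed_def Y_sgn .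
  ultimately have "(\<lambda>h. dd (0, h) Y (x, t)) = (\<lambda>h. h *\<^sub>R (speed t (sgn x) *\<^sub>R outer_normal X t (sgn x)))"
    by (rule has_derivative_unique)
  from fun_cong[OF this, of 1] show ?thesis by (simp add: Yt_def)
qed

text \<open>Degree 1 instead of 0 keeps the radial derivative from vanishing, so that the derivative
  in space can be invertible.\<close>

definition nu :: "(real^3) \<times> real \<Rightarrow> real^3" where "nu z = (norm (fst z) * inverse (norm (Yt z))) *\<^sub>R Yt z"

lemma norm_Yt: "(x, t) \<in> D \<Longrightarrow> norm (Yt (x, t)) = speed t (sgn x) \<and> speed t (sgn x) > 0"
  using Yt_eq[of x t] speed_pos[of t "sgn x"] sgn_S2[of x] outer_normal_spec(1)[of t "sgn x"] by (simp add: D_iff)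

lemma nu_eq: "(x, t) \<in> D \<Longrightarrow> nu (x, t) = norm x *\<^sub>R outer_normal X t (sgn x)"
proof -
  assume xt: "(x, t) \<in> D"
  have n: "norm (Yt (x, t)) = speed t (sgn x)" "speed t (sgn x) > 0" using norm_Yt[OF xt] by auto
  show ?thesis unfolding nu_def fst_conv n(1) unfolding Yt_eq[OF xt] using n(2) by simp
qed

lemma smooth_nu: "smooth_on D nu"
  unfolding nu_def
  by (intro smooth_on_scaleR smooth_on_mult smooth_on_inverse smooth_on_norm smooth_Yt smooth_norm open_D)
     (use norm_Yt in force)+

lemma nu_hom: "c > 0 \<Longrightarrow> (x, t) \<in> D \<Longrightarrow> nu (c *\<^sub>R x, t) = c *\<^sub>R nu (x, t)"
  using nu_eq[of "c *\<^sub>R x" t] nu_eq[of x t] by (simp add: D_iff sgn_scaleR)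

lemma norm_nu: "z \<in> D \<Longrightarrow> norm (nu z) = norm (fst z)"
  using nu_eq[of "fst z" "snd z"] outer_normal_spec(1)[of "snd z" "sgn (fst z)"] sgn_S2 by (auto simp: D_def)

text \<open>\<open>nu\<close> preserves length. Hence its derivative maps the plane orthogonal to
  the parameter to the plane orthogonal to \<open>nu\<close>, and it detects the radial
  component.\<close>

lemma dd_nu_inner: "z \<in> D \<Longrightarrow> nu z \<bullet> dd (v, 0) nu z = fst z \<bullet> v"
proof -
  assume z: "z \<in> D"
  have "dd (v, 0) (\<lambda>z. nu z \<bullet> nu z) z = dd (v, 0) (\<lambda>z. fst z \<bullet> fst z) z"
    by (rule dd_cong_open[OF open_D z]) (use norm_nu in \<open>simp add: norm_eq_sqrt_inner\<close>)
  moreover have "dd (v, 0) fst z = fst (v, 0 :: real)"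
    by (rule dd_eqI) (rule bounded_linear_imp_has_derivative[OF bounded_linear_fst])
  ultimately show ?thesis
    by (simp add: dd_bilinear[OF open_D bounded_bilinear_inner smooth_nu smooth_nu z]
        dd_bilinear[OF open_D bounded_bilinear_inner smooth_fst smooth_fst z] inner_commute)
qed

lemma dd_nu_scale:
  assumes "(x, t) \<in> D"
  shows "dd (v, 0) nu (x, t) = dd (v, 0) nu (sgn x, t)"
proof -
  have x: "x \<noteq> 0" using assms by (simp add: D_iff)
  have s: "(sgn x, t) \<in> D" using assms by (simp add: D_iff sgn_zero_iff)
  have "dd (norm x *\<^sub>R (v /\<^sub>R norm x), 0) nu (norm x *\<^sub>R sgn x, t) = norm x *\<^sub>R dd (v /\<^sub>R norm x, 0) nu (sgn x, t)"
    by (rule dd_homogeneous[OF smooth_nu _ s]) (use x nu_hom in auto)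
  also have "dd (v /\<^sub>R norm x, 0) nu (sgn x, t) = dd (v, 0) nu (sgn x, t) /\<^sub>R norm x"
    by (rule linear_cmul[OF slice_linear[OF smooth_nu s]])
  finally show ?thesis using x by (simp add: sgn_div_norm)
qed

lemma dd_Y_scale:
  assumes "(x, t) \<in> D"
  shows "dd (v, 0) Y (x, t) = dd (v, 0) Y (sgn x, t) /\<^sub>R norm x"
proof -
  have x: "x \<noteq> 0" using assms by (simp add: D_iff)
  have s: "(sgn x, t) \<in> D" using assms by (simp add: D_iff sgn_zero_iff)
  have "dd (norm x *\<^sub>R (v /\<^sub>R norm x), 0) Y (norm x *\<^sub>R sgn x, t) = 1 *\<^sub>R dd (v /\<^sub>R norm x, 0) Y (sgn x, t)"
    by (rule dd_homogeneous[OF smooth_Y _ s]) (use x Y_hom in auto)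
  also have "dd (v /\<^sub>R norm x, 0) Y (sgn x, t) = dd (v, 0) Y (sgn x, t) /\<^sub>R norm x"
    by (rule linear_cmul[OF slice_linear[OF smooth_Y s]])
  finally show ?thesis using x by (simp add: sgn_div_norm)
qed

lemma dd_Y_radial:
  assumes "(x, t) \<in> D"
  shows "dd (x, 0) Y (x, t) = 0"
proof -
  have "((\<lambda>c. (c *\<^sub>R x, t)) has_derivative (\<lambda>h. h *\<^sub>R (x, 0))) (at 1)"
    by (auto intro!: derivative_eq_intros)
  then have 1: "((\<lambda>c. Y (c *\<^sub>R x, t)) has_derivative (\<lambda>h. dd (h *\<^sub>R (x, 0)) Y (x, t))) (at 1)"
    by (rule has_derivative_compose) (simp add: smooth_on_has_derivative[OF open_D smooth_Y assms, simplified])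
  have 2: "((\<lambda>c. Y (c *\<^sub>R x, t)) has_derivative (\<lambda>h. 0)) (at 1)"
    by (rule has_derivative_transform_within_open[OF has_derivative_const, of "{0<..}"]) (simp_all add: Y_hom)
  show ?thesis using fun_cong[OF has_derivative_unique[OF 1 2], of 1] by simp
qed

lemma tangent_split: "p \<in> S2 \<Longrightarrow> (v - (v \<bullet> p) *\<^sub>R p) \<bullet> p = 0"
  by (simp add: S2_iff inner_diff_left norm_eq_1)

lemma nu_normal:
  assumes "z \<in> D"
  shows "nu z \<bullet> dd (v, 0) Y z = 0"
proof -
  obtain x t where z: "z = (x, t)" by force
  have t: "t \<in> {a<..<b}" and x: "x \<noteq> 0" using assms by (auto simp: z D_iff)
  define p where "p = sgn x"
  have p: "p \<in> S2" "(p, t) \<in> D" using sgn_S2[OF x] S2_D t by (auto simp: p_def)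
  have "dd (v, 0) Y (p, t) = dd (v - (v \<bullet> p) *\<^sub>R p, 0) Y (p, t) + (v \<bullet> p) *\<^sub>R dd (p, 0) Y (p, t)"
    using linear_add[OF slice_linear[OF smooth_Y p(2)], of "v - (v \<bullet> p) *\<^sub>R p" "(v \<bullet> p) *\<^sub>R p"]
      linear_cmul[OF slice_linear[OF smooth_Y p(2)], of "v \<bullet> p" p] by simp
  then have "outer_normal X t p \<bullet> dd (v, 0) Y (p, t) = 0"
    using outer_normal_spec(2)[OF t p(1) tangent_split[OF p(1)]] dd_Y_radial[OF p(2)] by simp
  then show ?thesis
    using nu_eq[of x t] dd_Y_scale[of x t v] assms by (simp add: z p_def)
qed

section \<open>Principal curvatures and invertibility of the derivative of \<open>nu\<close>\<close>

lemma principal_curvatures_eq: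
  assumes "t \<in> {a<..<b}" "p \<in> S2"
  shows "principal_curvatures X t p
    = {l. \<exists>v. v \<bullet> p = 0 \<and> v \<noteq> 0 \<and> dd (v, 0) nu (p, t) = l *\<^sub>R dd (v, 0) Y (p, t)}"
proof -
  have "nu (q, t) = outer_normal X t q" if "q \<in> S2" for q
    using nu_eq[OF S2_D[OF that assms(1)]] that by (simp add: sgn_id S2_iff)
  then have "frechet_derivative (\<lambda>q. outer_normal X t q) (at p within S2) v = dd (v, 0) nu (p, t)"
    if "v \<bullet> p = 0" for v
    by (intro frechet_slice[OF smooth_nu assms(1) _ assms(2) that])
  then show ?thesis unfolding principal_curvatures_def using dX_eq[OF assms] by (intro Collect_cong ex_cong1) auto
qed

text \<open>A kernel vector would be a principal direction with curvature 0; there is at most one other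
  principal curvature then, so the minimum \<open>kappa2\<close> is genuine and not positive.\<close>
lemma dd_nu_tangent_nonzero:
  assumes t: "t \<in> {a<..<b}" and p: "p \<in> S2" and v: "v \<bullet> p = 0" "v \<noteq> 0"
  shows "dd (v, 0) nu (p, t) \<noteq> 0"
proof
  assume v0: "dd (v, 0) nu (p, t) = 0"
  define A C where "A w = dd (w, 0) nu (p, t)" and "C w = dd (w, 0) Y (p, t)" for w
  note pt = S2_D[OF p t]
  have lin: "linear A" "linear C"
    unfolding A_def C_def by (intro slice_linear smooth_nu smooth_Y pt)+
  have PC: "principal_curvatures X t p = {l. \<exists>w. w \<bullet> p = 0 \<and> w \<noteq> 0 \<and> A w = l *\<^sub>R C w}"
    unfolding A_def C_def by (rule principal_curvatures_eq[OF t p])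
  have C0: "C w \<noteq> 0" if "w \<bullet> p = 0" "w \<noteq> 0" for w
    unfolding C_def by (rule dd_Y_nonzero[OF t p that])
  have np: "norm p = 1" using p by (simp add: S2_iff)
  define e1 where "e1 = sgn v"
  define e2 where "e2 = cross3 p e1"
  have e1: "norm e1 = 1" "e1 \<bullet> p = 0" "A e1 = 0" "e1 \<noteq> 0"
    using v v0 linear_cmul[OF lin(1)] by (auto simp: e1_def norm_sgn sgn_div_norm A_def[symmetric])
  define k where "k = (C e2 \<bullet> C e1) / (C e1 \<bullet> C e1)"
  define w where "w = e2 - k *\<^sub>R e1"
  have e2: "e2 \<bullet> p = 0" "e2 \<bullet> e1 = 0" "e2 \<bullet> e2 = 1"
    using e1 np by (auto simp: e2_def dot_cross_self dot_cross norm_eq_1 inner_commute)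
  have w: "w \<bullet> p = 0" "w \<noteq> 0"
    using e1 e2 by (auto simp: w_def inner_diff_left)
  have "C e1 \<bullet> C e1 \<noteq> 0" using C0[OF e1(2,4)] by simp
  then have Cw: "C w \<bullet> C e1 = 0"
    by (simp add: w_def linear_diff[OF lin(2)] linear_cmul[OF lin(2)] inner_diff_left k_def)
  have "principal_curvatures X t p \<subseteq> {0, (C w \<bullet> A w) / (C w \<bullet> C w)}"
  proof
    fix l assume "l \<in> principal_curvatures X t p"
    then obtain u where u: "u \<bullet> p = 0" "u \<noteq> 0" "A u = l *\<^sub>R C u" unfolding PC by blast
    define y where "y = u \<bullet> e2"
    define x where "x = u \<bullet> e1 + k * y"
    have uxy: "u = x *\<^sub>R e1 + y *\<^sub>R w"
      using orthonormal_plane[OF np e1(1,2) u(1)] by (simp add: x_def y_def w_def e2_def algebra_simps)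
    have Au: "A u = y *\<^sub>R A w" and Cu: "C u = x *\<^sub>R C e1 + y *\<^sub>R C w"
      unfolding uxy linear_add[OF lin(1)] linear_cmul[OF lin(1)] linear_add[OF lin(2)] linear_cmul[OF lin(2)]
      using e1(3) by simp_all
    have eq: "y * (C w \<bullet> A w) = l * (y * (C w \<bullet> C w))"
      using arg_cong[OF u(3), of "\<lambda>z. C w \<bullet> z"] Cw unfolding Au Cu by (simp add: inner_add_right)
    show "l \<in> {0, (C w \<bullet> A w) / (C w \<bullet> C w)}"
    proof (cases "y = 0")
      case True
      then have "l *\<^sub>R C u = 0" using u(3) Au by simp
      then show ?thesis using C0[OF u(1,2)] by simp
    next
      case False
      then show ?thesis using eq C0[OF w] by (simp add: field_simps)
    qed
  qed
  \<comment> \<open>\<open>Min\<close> of an infinite set would be an unspecified value.\<close>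
  then have "finite (principal_curvatures X t p)" using finite_subset by blast
  moreover have "0 \<in> principal_curvatures X t p"
    unfolding PC using v v0 by (auto simp: A_def)
  ultimately have "kappa2 X t p \<le> 0" unfolding kappa2_def by (rule Min_le)
  then show False using kappa_pos[OF t p] by simp
qed

text \<open>A kernel vector has no radial component by \<open>dd_nu_inner\<close> and no tangential
  one by \<open>dd_nu_tangent_nonzero\<close>.\<close>

lemma inj_dd_nu:
  assumes "z \<in> D"
  shows "inj (\<lambda>v. dd (v, 0) nu z)"
proof (rule linear_injective_0[OF slice_linear[OF smooth_nu assms], THEN iffD2], intro allI impI)
  fix v assume v: "dd (v, 0) nu z = 0"
  obtain x t where z: "z = (x, t)" by force
  have t: "t \<in> {a<..<b}" and x: "x \<noteq> 0" using assms by (auto simp: z D_iff)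
  define p where "p = sgn x"
  have p: "p \<in> S2" "(p, t) \<in> D" using sgn_S2[OF x] S2_D t by (auto simp: p_def)
  have v': "dd (v, 0) nu (p, t) = 0" using v dd_nu_scale[of x t v] assms by (simp add: z p_def)
  then have "v \<bullet> p = 0" using dd_nu_inner[OF p(2), of v] by (simp add: inner_commute)
  then show "v = 0" using dd_nu_tangent_nonzero[OF t p(1)] v' by blast
qed

section \<open>Fields along which \<open>nu\<close> has constant derivative\<close>

definition Jinv :: "real^3 \<Rightarrow> (real^3) \<times> real \<Rightarrow> real^3" where
  "Jinv w z = inverse3 (dd (axis 1 1, 0) nu z) (dd (axis 2 1, 0) nu z) (dd (axis 3 1, 0) nu z) w"

lemma dd_nu_Jinv: "z \<in> D \<Longrightarrow> dd (Jinv w z, 0) nu z = w"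
  unfolding Jinv_def by (rule inverse3(1)[OF slice_linear[OF smooth_nu] inj_dd_nu])

lemma Jinv_unique: "z \<in> D \<Longrightarrow> dd (v, 0) nu z = w \<Longrightarrow> Jinv w z = v"
  using injD[OF inj_dd_nu, of z "Jinv w z" v] dd_nu_Jinv[of z w] by simp

lemma smooth_Jinv:
  assumes "smooth_on D w"
  shows "smooth_on D (\<lambda>z. Jinv (w z) z)"
proof -
  have "dd (axis 1 1, 0) nu z \<bullet> cross3 (dd (axis 2 1, 0) nu z) (dd (axis 3 1, 0) nu z) \<noteq> 0" if "z \<in> D" for z
    by (rule inverse3(2)[OF slice_linear[OF smooth_nu that] inj_dd_nu[OF that]])
  then show ?thesis
    unfolding Jinv_def inverse3_def
    by (intro smooth_on_scaleR smooth_on_add smooth_on_inner smooth_on_inverse smooth_on_cross3 smooth_on_const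
        smooth_on_dd smooth_nu open_D assms)
qed

lemma linear_Jinv: "linear (\<lambda>w. Jinv w z)"
  unfolding Jinv_def inverse3_def
  by (rule linearI) (simp_all add: inner_add_right algebra_simps)

definition Ef :: "real^3 \<Rightarrow> (real^3) \<times> real \<Rightarrow> (real^3) \<times> real" where "Ef w z = (Jinv w z, 0)"

text \<open>The time derivative at fixed normal: the spatial part cancels the change of
  \<open>nu\<close> at a fixed parameter.\<close>

definition Et :: "(real^3) \<times> real \<Rightarrow> (real^3) \<times> real" where "Et z = (- Jinv (dd (0, 1) nu z) z, 1)"

lemma smooth_Ef: "smooth_on D (Ef w)"
  unfolding Ef_def by (intro smooth_on_Pair smooth_Jinv smooth_on_const open_D)

lemma smooth_Et: "smooth_on D Et"
  unfolding Et_def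
  by (intro smooth_on_Pair smooth_on_uminus smooth_Jinv smooth_on_const smooth_on_dd smooth_nu open_D)

lemma dd_split:
  assumes "smooth_on D f" "z \<in> D"
  shows "dd (v, 1) f z = dd (v, 0) f z + dd (0, 1) f z"
  using linear_add[OF dd_linear[OF open_D assms], of "(v, 0)" "(0, 1)"] by simp

lemma dd_Et:
  assumes "smooth_on D f" "z \<in> D"
  shows "dd (Et z) f z = dd (0, 1) f z - dd (Jinv (dd (0, 1) nu z) z, 0) f z"
  using dd_split[OF assms, of "- Jinv (dd (0, 1) nu z) z"]
    linear_neg[OF slice_linear[OF assms], of "Jinv (dd (0, 1) nu z) z"]
  by (simp add: Et_def del: add_uminus_conv_diff)

lemma dd_nu_Ef: "z \<in> D \<Longrightarrow> dd (Ef w z) nu z = w"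
  unfolding Ef_def by (rule dd_nu_Jinv)

lemma dd_nu_Et: "z \<in> D \<Longrightarrow> dd (Et z) nu z = 0"
  by (simp add: dd_Et[OF smooth_nu] dd_nu_Jinv)

lemma dd_snd: "dd v snd z = snd v"
  by (rule dd_eqI) (rule bounded_linear_imp_has_derivative[OF bounded_linear_snd])

lemma dd_inner_const:
  assumes "smooth_on D f" "z \<in> D"
  shows "dd v (\<lambda>z. f z \<bullet> w) z = dd v f z \<bullet> w"
  using dd_bilinear[OF open_D bounded_bilinear_inner assms(1) smooth_on_const[OF open_D] assms(2)]
  by (simp add: dd_const)

text \<open>The components of \<open>nu\<close> together with time are local coordinates, since the
  derivative of \<open>nu\<close> in space is injective; in the index type \<open>None\<close>
  stands for time.\<close>

lemma fields_commute:
  assumes "smooth_on D E" "smooth_on D F" "smooth_on D f" "z \<in> D"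
    and "\<And>z. z \<in> D \<Longrightarrow> dd (E z) nu z = c" "\<And>z. z \<in> D \<Longrightarrow> dd (F z) nu z = d"
    and "\<And>z. snd (E z) = e" "\<And>z. snd (F z) = e'"
  shows "LD E (LD F f) z = LD F (LD E f) z"
proof -
  define g where "g = (\<lambda>j::3 option. case j of None \<Rightarrow> snd | Some j \<Rightarrow> (\<lambda>z. nu z \<bullet> axis j 1))"
  have g: "smooth_on D (g j)" for j
    by (cases j) (auto simp: g_def intro!: smooth_snd smooth_on_inner smooth_nu smooth_on_const open_D)
  have dg: "dd v (g j) z = (case j of None \<Rightarrow> snd v | Some j \<Rightarrow> dd v nu z \<bullet> axis j 1)" if "z \<in> D" for v j z
    by (cases j) (simp_all add: g_def dd_snd dd_inner_const[OF smooth_nu that])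
  show ?thesis
  proof (rule LD_commute[OF open_D assms(1-4), of UNIV g])
    show "LD E (g j) y = (case j of None \<Rightarrow> e | Some j \<Rightarrow> c \<bullet> axis j 1)" if "y \<in> D" for j y
      unfolding LD_def dg[OF that] using assms(5)[OF that] assms(7) by (simp split: option.split)
    show "LD F (g j) y = (case j of None \<Rightarrow> e' | Some j \<Rightarrow> d \<bullet> axis j 1)" if "y \<in> D" for j y
      unfolding LD_def dg[OF that] using assms(6)[OF that] assms(8) by (simp split: option.split)
    fix v assume v: "\<And>j. j \<in> UNIV \<Longrightarrow> dd v (g j) z = 0"
    have "snd v = 0" using v[of None] by (simp add: dg[OF assms(4)])
    then have v': "v = (fst v, 0)" by (simp add: prod_eq_iff)
    have "dd (fst v, 0) nu z $ j = 0" for j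
      using v[of "Some j"] v' by (simp add: dg[OF assms(4)] inner_axis)
    then have "dd (fst v, 0) nu z = dd (0, 0) nu z"
      using linear_0[OF slice_linear[OF smooth_nu assms(4)]] by (simp add: vec_eq_iff)
    then have "fst v = 0" by (rule injD[OF inj_dd_nu[OF assms(4)]])
    then show "v = 0" using v' by (simp add: prod_eq_iff)
  qed (rule g)
qed

section \<open>The support function and its Hessian\<close>

definition h :: "(real^3) \<times> real \<Rightarrow> real" where "h z = nu z \<bullet> Y z"

text \<open>Over points of the sphere, on the plane orthogonal to \<open>nu\<close>, this is the
  inverse of the Weingarten map; \<open>LD_LD_h\<close> identifies it with the Hessian of
  \<open>h\<close> as a function of the normal.\<close>

definition Bop :: "(real^3) \<times> real \<Rightarrow> real^3 \<Rightarrow> real^3" where "Bop z w = dd (Jinv w z, 0) Y z"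

lemma smooth_h: "smooth_on D h"
  unfolding h_def by (intro smooth_on_inner smooth_nu smooth_Y open_D)

lemma dd_h: "z \<in> D \<Longrightarrow> dd v h z = nu z \<bullet> dd v Y z + dd v nu z \<bullet> Y z"
  unfolding h_def by (rule dd_bilinear[OF open_D bounded_bilinear_inner smooth_nu smooth_Y])

text \<open>The gradient of the support function is the position vector, because \<open>nu\<close>
  is orthogonal to the surface.\<close>

lemma LD_h: "z \<in> D \<Longrightarrow> LD (Ef w) h z = Y z \<bullet> w"
  by (simp add: LD_def dd_h dd_nu_Ef) (simp add: Ef_def nu_normal inner_commute)

lemma LD_LD_h:
  assumes "z \<in> D"
  shows "LD (Ef w) (LD (Ef w') h) z = Bop z w \<bullet> w'"
proof -
  have "LD (Ef w) (LD (Ef w') h) z = LD (Ef w) (\<lambda>z. Y z \<bullet> w') z"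
    by (rule LD_cong[OF open_D LD_h assms])
  then show ?thesis by (simp add: LD_def dd_inner_const[OF smooth_Y assms] Bop_def Ef_def)
qed

lemma linear_Bop: "z \<in> D \<Longrightarrow> linear (Bop z)"
  unfolding Bop_def using linear_compose[OF linear_Jinv slice_linear[OF smooth_Y]] by (simp add: o_def)

text \<open>Second derivatives of \<open>h\<close> along the frame fields commute.\<close>

lemma Bop_sym: "z \<in> D \<Longrightarrow> Bop z v \<bullet> w = v \<bullet> Bop z w"
  using fields_commute[where e = 0 and e' = 0, OF smooth_Ef smooth_Ef smooth_h _ dd_nu_Ef dd_nu_Ef, of z v w]
  by (simp add: LD_LD_h inner_commute) (simp add: Ef_def)

lemma nu_Bop: "z \<in> D \<Longrightarrow> nu z \<bullet> Bop z w = 0"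
  unfolding Bop_def by (rule nu_normal)

lemma Bop_nu: "z \<in> D \<Longrightarrow> Bop z (nu z) = 0"
  using Bop_sym[of z "nu z" "Bop z (nu z)"] nu_Bop[of z "Bop z (nu z)"] by simp

lemma Bop_scale: "(x, t) \<in> D \<Longrightarrow> Bop (x, t) w = Bop (sgn x, t) w /\<^sub>R norm x"
  unfolding Bop_def using dd_Y_scale[of x t] by (simp add: Jinv_def dd_nu_scale[of x t])

text \<open>Only the normal velocity counts: \<open>Et\<close> annihilates \<open>nu\<close>, and
  its spatial part moves \<open>Y\<close> tangentially.\<close>

lemma LD_Et_h:
  assumes "(x, t) \<in> D"
  shows "LD Et h (x, t) = norm x * speed t (sgn x)"
proof -
  have "x \<noteq> 0" "t \<in> {a<..<b}" using assms by (auto simp: D_iff)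
  then have n: "outer_normal X t (sgn x) \<bullet> outer_normal X t (sgn x) = 1"
    using outer_normal_spec(1) sgn_S2 by (simp add: norm_eq_1)
  have "LD Et h (x, t) = nu (x, t) \<bullet> Yt (x, t)"
    by (simp add: LD_def dd_h[OF assms] dd_nu_Et[OF assms] dd_Et[OF smooth_Y assms] inner_diff_right
        nu_normal[OF assms] Yt_def)
  then show ?thesis using n by (simp add: nu_eq[OF assms] Yt_eq[OF assms])
qed

section \<open>Principal radii and the pinching quantity\<close>

lemma principal_curvatures_Bop:
  assumes "t \<in> {a<..<b}" "p \<in> S2"
  shows "principal_curvatures X t p
    = {l. \<exists>w. w \<bullet> nu (p, t) = 0 \<and> w \<noteq> 0 \<and> w = l *\<^sub>R Bop (p, t) w}" (is "_ = ?P")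
proof -
  note pt = S2_D[OF assms(2,1)]
  note lin = slice_linear[OF smooth_nu pt]
  have perp: "dd (v, 0) nu (p, t) \<bullet> nu (p, t) = v \<bullet> p" for v
    using dd_nu_inner[OF pt, of v] by (simp add: inner_commute)
  show ?thesis
    unfolding principal_curvatures_eq[OF assms]
  proof (intro Collect_cong iffI)
    fix l
    assume "\<exists>v. v \<bullet> p = 0 \<and> v \<noteq> 0 \<and> dd (v, 0) nu (p, t) = l *\<^sub>R dd (v, 0) Y (p, t)"
    then obtain v where v: "v \<bullet> p = 0" "v \<noteq> 0" "dd (v, 0) nu (p, t) = l *\<^sub>R dd (v, 0) Y (p, t)" by blast
    have "Bop (p, t) (dd (v, 0) nu (p, t)) = dd (v, 0) Y (p, t)"
      unfolding Bop_def using Jinv_unique[OF pt refl] by simp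
    then show "\<exists>w. w \<bullet> nu (p, t) = 0 \<and> w \<noteq> 0 \<and> w = l *\<^sub>R Bop (p, t) w"
      using v perp[of v] dd_nu_tangent_nonzero[OF assms v(1,2)] by (intro exI[of _ "dd (v, 0) nu (p, t)"]) simp
  next
    fix l
    assume "\<exists>w. w \<bullet> nu (p, t) = 0 \<and> w \<noteq> 0 \<and> w = l *\<^sub>R Bop (p, t) w"
    then obtain w where w: "w \<bullet> nu (p, t) = 0" "w \<noteq> 0" "w = l *\<^sub>R Bop (p, t) w" by blast
    define v where "v = Jinv w (p, t)"
    have v: "dd (v, 0) nu (p, t) = w" unfolding v_def by (rule dd_nu_Jinv[OF pt])
    have "v \<noteq> 0" using v w(2) linear_0[OF lin] by auto
    then show "\<exists>v. v \<bullet> p = 0 \<and> v \<noteq> 0 \<and> dd (v, 0) nu (p, t) = l *\<^sub>R dd (v, 0) Y (p, t)"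
      using v perp[of v] w by (intro exI[of _ v]) (simp add: Bop_def v_def)
  qed
qed

lemma Bop_ker:
  assumes "t \<in> {a<..<b}" "p \<in> S2" "w \<bullet> nu (p, t) = 0" "Bop (p, t) w = 0"
  shows "w = 0"
proof -
  note pt = S2_D[OF assms(2,1)]
  define v where "v = Jinv w (p, t)"
  have v: "dd (v, 0) nu (p, t) = w" unfolding v_def by (rule dd_nu_Jinv[OF pt])
  have "v \<bullet> p = 0" using dd_nu_inner[OF pt, of v] v assms(3) by (simp add: inner_commute)
  then have "v = 0" using dd_Y_nonzero[OF assms(1,2)] assms(4) by (auto simp: Bop_def v_def)
  then show "w = 0" using v linear_0[OF slice_linear[OF smooth_nu pt]] by simp
qed

definition pinching :: "real \<Rightarrow> real^3 \<Rightarrow> real" where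
  "pinching t p = (kappa1 X t p - kappa2 X t p)\<^sup>2 /
        (2 * (kappa1 X t p + kappa2 X t p) * kappa1 X t p * kappa2 X t p)"

text \<open>\<open>s\<close> and \<open>q\<close> are the sums of the principal radii and of their
  squares. The eigenvector in the last claim serves to diagonalise the Hessian at a maximum
  point.\<close>

lemma curvature_radii:
  assumes t: "t \<in> {a<..<b}" and p: "p \<in> S2" and f: "orthonormal f"
  defines "s \<equiv> \<Sum>i\<in>UNIV. f i \<bullet> Bop (p, t) (f i)"
    and "q \<equiv> \<Sum>i\<in>UNIV. \<Sum>j\<in>UNIV. (f j \<bullet> Bop (p, t) (f i))\<^sup>2"
  shows "s > 0" "speed t p = s\<^sup>2" "q - s\<^sup>2 / 2 = s * pinching t p"
    and "\<exists>e k. norm e = 1 \<and> e \<bullet> nu (p, t) = 0 \<and> Bop (p, t) e = k *\<^sub>R e"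
proof -
  note pt = S2_D[OF p t]
  have n: "norm (nu (p, t)) = 1" using norm_nu[OF pt] p by (simp add: S2_iff)
  obtain k l where kl: "principal_curvatures X t p = {k, l}" "s * (k * l) = k + l" "(s\<^sup>2 - q) * (k * l) = 2"
    unfolding s_def q_def principal_curvatures_Bop[OF t p]
    by (rule reciprocal_eigenvalues[OF linear_Bop[OF pt] Bop_sym[OF pt] n Bop_nu[OF pt] Bop_ker[OF t p] f])
  have k12: "kappa1 X t p = max k l" "kappa2 X t p = min k l"
    by (simp_all add: kappa1_def kappa2_def kl(1))
  then have pos: "k > 0" "l > 0" using kappa_pos[OF t p] by auto
  then have kl0: "k * l > 0" by simp
  have s: "s = (k + l) / (k * l)" by (subst eq_divide_eq) (use kl(2) kl0 in auto)
  show "s > 0" unfolding s using pos kl0 by simp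
  have hk: "mean_curv X t p = k + l" "gauss_curv X t p = k * l"
    by (auto simp: mean_curv_def gauss_curv_def k12 max_def min_def)
  show "speed t p = s\<^sup>2" by (simp add: speed_def hk s power_divide)
  have "s\<^sup>2 - q = 2 / (k * l)" by (subst eq_divide_eq) (use kl(3) kl0 in auto)
  then have q: "q = s\<^sup>2 - 2 / (k * l)" by simp
  define m n where "m = k + l" and "n = k * l"
  have mn: "m > 0" "n > 0" and smn: "s = m / n" using pos by (simp_all add: m_def n_def s)
  have "pinching t p = (k - l)\<^sup>2 / (2 * m * n)"
    by (auto simp: pinching_def k12 max_def min_def power2_commute ac_simps m_def n_def)
  then have "s * pinching t p = (k - l)\<^sup>2 / (2 * n\<^sup>2)"
    using mn unfolding smn by (simp add: power2_eq_square)
  also have "(k - l)\<^sup>2 = m\<^sup>2 - 4 * n"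
    by (simp add: m_def n_def power2_eq_square algebra_simps)
  also have "(m\<^sup>2 - 4 * n) / (2 * n\<^sup>2) = s\<^sup>2 / 2 - 2 / (k * l)"
    using mn unfolding smn n_def[symmetric] by (simp add: diff_divide_distrib power2_eq_square)
  finally show "q - s\<^sup>2 / 2 = s * pinching t p" unfolding q by simp
  have "k \<in> principal_curvatures X t p" by (simp add: kl(1))
  then obtain w where w: "w \<bullet> nu (p, t) = 0" "w \<noteq> 0" "w = k *\<^sub>R Bop (p, t) w"
    unfolding principal_curvatures_Bop[OF t p] by blast
  have "Bop (p, t) w = inverse k *\<^sub>R w"
    using arg_cong[OF w(3), of "\<lambda>v. inverse k *\<^sub>R v"] pos by simp
  then have "Bop (p, t) (sgn w) = inverse k *\<^sub>R sgn w"
    by (simp add: sgn_div_norm linear_cmul[OF linear_Bop[OF pt]])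
  then show "\<exists>e k. norm e = 1 \<and> e \<bullet> nu (p, t) = 0 \<and> Bop (p, t) e = k *\<^sub>R e"
    using w(1,2) by (intro exI[of _ "sgn w"] exI[of _ "inverse k"]) (simp add: norm_sgn sgn_div_norm)
qed

text \<open>The orthonormal frame stays arbitrary so that it can be adapted to the point under
  consideration.\<close>

lemma frame:
  assumes f: "orthonormal f"
  shows "support_frame D (\<lambda>i. Ef (f i)) Et (\<lambda>i z. nu z \<bullet> f i) (\<lambda>z. norm (fst z)) h"
proof
  show "open D" by (rule open_D)
  show "smooth_on D (Ef (f i))" for i by (rule smooth_Ef)
  show "smooth_on D Et" by (rule smooth_Et)
  show "smooth_on D (\<lambda>z. nu z \<bullet> f i)" for i by (intro smooth_on_inner smooth_nu smooth_on_const open_D)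
  show "smooth_on D (\<lambda>z. norm (fst z))" by (rule smooth_norm)
  show "smooth_on D h" by (rule smooth_h)
  show "LD (Ef (f i)) (LD (Ef (f j)) g) x = LD (Ef (f j)) (LD (Ef (f i)) g) x" if "smooth_on D g" "x \<in> D" for g x i j
    by (rule fields_commute[where e = 0 and e' = 0, OF smooth_Ef smooth_Ef that dd_nu_Ef dd_nu_Ef]) (simp_all add: Ef_def)
  show "LD Et (LD (Ef (f j)) g) x = LD (Ef (f j)) (LD Et g) x" if "smooth_on D g" "x \<in> D" for g x j
    by (rule fields_commute[where e = 1 and e' = 0, OF smooth_Et smooth_Ef that dd_nu_Et dd_nu_Ef]) (simp_all add: Ef_def Et_def)
  show "LD (Ef (f i)) (\<lambda>z. nu z \<bullet> f j) x = (if i = j then 1 else 0)" if "x \<in> D" for x i j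
    using f unfolding LD_def dd_inner_const[OF smooth_nu that] dd_nu_Ef[OF that] orthonormal_def by blast
  show "LD Et (\<lambda>z. nu z \<bullet> f j) x = 0" if "x \<in> D" for x j
    unfolding LD_def dd_inner_const[OF smooth_nu that] dd_nu_Et[OF that] by simp
  show "norm (fst x) > 0" if "x \<in> D" for x using that by (auto simp: D_def)
  show "norm (fst x) * norm (fst x) = (\<Sum>i\<in>UNIV. nu x \<bullet> f i * (nu x \<bullet> f i))" if "x \<in> D" for x
    using orthonormal_inner[OF f, of "nu x" "nu x"] norm_nu[OF that]
    by (simp add: inner_commute power2_norm_eq_inner[symmetric] power2_eq_square)
  show "(\<Sum>j\<in>UNIV. nu x \<bullet> f j * LD (Ef (f i)) (LD (Ef (f j)) h) x) = 0" if "x \<in> D" for x i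
    using orthonormal_inner[OF f, of "nu x" "Bop x (f i)"] nu_Bop[OF that]
    by (simp add: LD_LD_h[OF that] inner_commute)
  fix z assume z: "z \<in> D"
  obtain x t where xt: "z = (x, t)" by force
  have x: "x \<noteq> 0" "t \<in> {a<..<b}" using z by (auto simp: xt D_iff)
  have "(\<Sum>i\<in>UNIV. LD (Ef (f i)) (LD (Ef (f i)) h) z) = (\<Sum>i\<in>UNIV. f i \<bullet> Bop (sgn x, t) (f i)) / norm x"
    using z unfolding xt
    by (simp add: LD_LD_h[of "(x, t)"] Bop_scale[of x t] sum_distrib_left inner_commute divide_inverse_commute)
  then show "LD Et h z = norm (fst z) * (norm (fst z) * (\<Sum>i\<in>UNIV. LD (Ef (f i)) (LD (Ef (f i)) h) z))\<^sup>2"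
    using LD_Et_h[of x t] z x(1) curvature_radii(2)[OF x(2) sgn_S2[OF x(1)] f] by (simp add: xt)
qed

lemma frame_values:
  assumes f: "orthonormal f" and xt: "(x, t) \<in> D"
  defines "E \<equiv> \<lambda>i. Ef (f i)" and "rho \<equiv> (\<lambda>z :: (real^3) \<times> real. norm (fst z))"
  shows "support_frame.u E rho h (x, t) > 0"
    and "support_frame.phi E rho h M (x, t) = support_frame.u E rho h (x, t) * (pinching t (sgn x) - M)"
proof -
  interpret sf: support_frame D E Et "\<lambda>i z. nu z \<bullet> f i" rho h
    unfolding E_def rho_def by (rule frame[OF f])
  have x: "x \<noteq> 0" and t: "t \<in> {a<..<b}" using xt by (auto simp: D_iff)
  have bet: "sf.bet i j (x, t) = f j \<bullet> Bop (sgn x, t) (f i)" for i j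
    unfolding sf.bet_def sf.b_def using x
    by (simp add: E_def rho_def LD_LD_h[OF xt] Bop_scale[OF xt] inner_commute)
  note cr = curvature_radii[OF t sgn_S2[OF x] f]
  have u: "sf.u (x, t) = (\<Sum>i\<in>UNIV. f i \<bullet> Bop (sgn x, t) (f i))"
    by (simp add: sf.u_def bet)
  show "sf.u (x, t) > 0" unfolding u by (rule cr(1))
  have "sf.phi M (x, t) = (\<Sum>i\<in>UNIV. \<Sum>j\<in>UNIV. (f j \<bullet> Bop (sgn x, t) (f i))\<^sup>2) - (sf.u (x, t))\<^sup>2 / 2 - M * sf.u (x, t)"
    by (simp add: sf.phi_def bet power2_eq_square)
  also have "\<dots> = sf.u (x, t) * (pinching t (sgn x) - M)"
    using cr(3) unfolding u[symmetric] by (simp add: algebra_simps)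
  finally show "sf.phi M (x, t) = sf.u (x, t) * (pinching t (sgn x) - M)" .
qed

section \<open>The maximum principle\<close>

text \<open>The definition through \<open>Max\<close> and \<open>Min\<close> shows no continuity;
  the quotient of the smooth functions \<open>phi 0\<close> and \<open>u\<close> does.\<close>

lemma continuous_pinching: "continuous_on (S2 \<times> {a<..<b}) (\<lambda>z. pinching (snd z) (fst z))"
proof -
  define f :: "3 \<Rightarrow> real^3" where "f i = axis i 1" for i
  have f: "orthonormal f" by (simp add: orthonormal_def f_def inner_axis_axis)
  interpret sf: support_frame D "\<lambda>i. Ef (f i)" Et "\<lambda>i z. nu z \<bullet> f i" "\<lambda>z. norm (fst z)" h
    by (rule frame[OF f])
  have sub: "S2 \<times> {a<..<b} \<subseteq> D" using S2_D by auto
  have sm: "smooth_on D (sf.phi 0)"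
    unfolding sf.phi_def divide_inverse by (intro sf.smooth_rules sf.smooth_bet sf.smooth_u)
  have "continuous_on (S2 \<times> {a<..<b}) (\<lambda>z. sf.phi 0 z / sf.u z)"
    by (intro continuous_on_divide continuous_on_subset[OF smooth_on_continuous[OF sm] sub]
        continuous_on_subset[OF smooth_on_continuous[OF sf.smooth_u] sub])
      (use frame_values(1)[OF f] sub in force)
  then show ?thesis
  proof (rule continuous_on_eq)
    fix z assume "z \<in> S2 \<times> {a<..<b}"
    then obtain p t where z: "z = (p, t)" "p \<in> S2" "t \<in> {a<..<b}" by auto
    show "sf.phi 0 z / sf.u z = pinching (snd z) (fst z)"
      using frame_values[OF f S2_D[OF z(2,3)]] z by (simp add: sgn_id)
  qed
qed

text \<open>At a spatial maximum the time derivative of \<open>phi M\<close> is not positive, while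
  \<open>past\<close> says that up to \<open>t0\<close> the pinching at \<open>p\<close> grew at
  rate at least \<open>eps\<close>.\<close>

lemma pinching_maximum_no_growth:
  assumes t0: "t0 \<in> {a<..<b}" and p: "p \<in> S2"
    and max: "\<And>q. q \<in> S2 \<Longrightarrow> pinching t0 q \<le> pinching t0 p"
    and eps: "eps > 0" and de: "de > 0"
    and past: "\<And>t. t0 - de < t \<Longrightarrow> t < t0 \<Longrightarrow> pinching t p - eps * t \<le> pinching t0 p - eps * t0"
  shows False
proof -
  note z = S2_D[OF p t0]
  have n: "norm (nu (p, t0)) = 1" using norm_nu[OF z] p by (simp add: S2_iff)
  have "orthonormal (\<lambda>i. axis i 1 :: real^3)" by (simp add: orthonormal_def inner_axis_axis)
  from curvature_radii(4)[OF t0 p this]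
  obtain e k where e: "norm e = 1" "e \<bullet> nu (p, t0) = 0" "Bop (p, t0) e = k *\<^sub>R e" by blast
  \<comment> \<open>\<open>e\<close> is a principal direction, so the Hessian is diagonal in this
    frame, and the third vector is radial.\<close>
  define f where "f = (\<lambda>i::3. if i = 1 then e else if i = 2 then cross3 (nu (p, t0)) e else nu (p, t0))"
  have f: "orthonormal f" unfolding f_def by (rule orthonormal_extend[OF n e(1,2)])
  interpret sf: support_frame D "\<lambda>i. Ef (f i)" Et "\<lambda>i z. nu z \<bullet> f i" "\<lambda>z. norm (fst z)" h
    by (rule frame[OF f])
  note fv = frame_values[OF f]
  define M where "M = pinching t0 p"
  have sm: "smooth_on D (sf.phi M)"
    unfolding sf.phi_def divide_inverse by (intro sf.smooth_rules sf.smooth_bet sf.smooth_u)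
  have phi0: "sf.phi M (p, t0) = 0" using fv(2)[OF z] p by (simp add: M_def sgn_id)
  have phi_le: "sf.phi M (x, t0) \<le> 0" if "(x, t0) \<in> D" for x
  proof -
    have "pinching t0 (sgn x) \<le> M" unfolding M_def using max sgn_S2 that by (simp add: D_iff)
    then show ?thesis using fv[OF that] by (simp add: mult_nonneg_nonpos)
  qed
  have crit: "dd (v, 0) (sf.phi M) (p, t0) = 0" for v
  proof -
    have "(\<lambda>v. dd (v, 0) (sf.phi M) (p, t0)) = (\<lambda>v. 0)"
    proof (rule differential_zero_maxmin[of p "- {0}" "\<lambda>x. sf.phi M (x, t0)"])
      show "((\<lambda>x. sf.phi M (x, t0)) has_derivative (\<lambda>v. dd (v, 0) (sf.phi M) (p, t0))) (at p)"
        by (rule slice_has_derivative[OF sm z])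
      show "(\<forall>y\<in>- {0}. sf.phi M (y, t0) \<le> sf.phi M (p, t0)) \<or> (\<forall>y\<in>- {0}. sf.phi M (p, t0) \<le> sf.phi M (y, t0))"
        using phi_le phi0 t0 by (auto simp: D_iff)
    qed (use p in \<open>auto simp: S2_iff\<close>)
    then show ?thesis by (rule fun_cong)
  qed
  have "LD Et (sf.phi M) (p, t0) \<le> 0"
  proof (rule sf.maximum_point_estimate[OF z])
    have "f 1 \<bullet> f 2 = 0" using f by (simp add: orthonormal_def)
    then show "sf.b 1 2 (p, t0) = 0"
      using e(3) by (simp add: sf.b_def LD_LD_h[OF z]) (simp add: f_def)
    have "nu (p, t0) = f 3" by (simp add: f_def)
    then show "nu (p, t0) \<bullet> f 1 = 0" "nu (p, t0) \<bullet> f 2 = 0" "nu (p, t0) \<bullet> f 3 = 1"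
      using f by (simp_all add: orthonormal_def)
    show "sf.u (p, t0) > 0" by (rule fv(1)[OF z])
    show "sf.phi M (p, t0) = 0" by (rule phi0)
    show "LD (Ef (f i)) (sf.phi M) (p, t0) = 0" for i
      by (simp add: LD_def Ef_def crit)
    show "LD (Ef (f i)) (LD (Ef (f i)) (sf.phi M)) (p, t0) \<le> 0" for i
    proof -
      define v where "v = Ef (f i) (p, t0)"
      have v: "v = (fst v, 0)" by (simp add: v_def Ef_def)
      \<comment> \<open>The frame field is not constant, but its derivative has no time component.
        So \<open>crit\<close> removes the first-order term, and the second derivative along the
        field is the one along the fixed vector \<open>v\<close>.\<close>
      have "snd (dd v (Ef (f i)) (p, t0)) = 0"
      proof -
        have "((\<lambda>z. snd (Ef (f i) z)) has_derivative (\<lambda>w. snd (dd w (Ef (f i)) (p, t0)))) (at (p, t0))"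
          by (rule bounded_linear.has_derivative[OF bounded_linear_snd])
             (rule smooth_on_has_derivative[OF open_D smooth_Ef z])
        moreover have "((\<lambda>z. snd (Ef (f i) z)) has_derivative (\<lambda>w. 0)) (at (p, t0))"
          by (simp add: Ef_def)
        ultimately have "(\<lambda>w. snd (dd w (Ef (f i)) (p, t0))) = (\<lambda>w. 0)" by (rule has_derivative_unique)
        then show ?thesis by (rule fun_cong)
      qed
      then have "dd v (Ef (f i)) (p, t0) = (fst (dd v (Ef (f i)) (p, t0)), 0)" by (simp add: prod_eq_iff)
      then have "dd (dd v (Ef (f i)) (p, t0)) (sf.phi M) (p, t0) = 0" using crit by metis
      then have "LD (Ef (f i)) (LD (Ef (f i)) (sf.phi M)) (p, t0) = dd v (dd v (sf.phi M)) (p, t0)"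
        using LD_LD_expand[OF open_D smooth_Ef smooth_Ef sm z, of "f i" "f i"] by (simp add: v_def)
      also have "\<dots> \<le> 0"
      proof (rule second_derivative_nonpos[OF open_D sm z])
        show "dd v (sf.phi M) (p, t0) = 0" using crit v by metis
        show "sf.phi M ((p, t0) + r *\<^sub>R v) \<le> sf.phi M (p, t0)" if "(p, t0) + r *\<^sub>R v \<in> D" for r
        proof -
          have "(p, t0) + r *\<^sub>R v = (p + r *\<^sub>R fst v, t0)" by (subst v) simp
          then show ?thesis using phi_le[of "p + r *\<^sub>R fst v"] that phi0 by simp
        qed
      qed
      finally show ?thesis .
    qed
  qed
  \<comment> \<open>By \<open>crit\<close> the spatial part of \<open>Et\<close> contributes
    nothing, so the time derivatives at fixed normal and at fixed parameter agree here.\<close>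
  moreover have "LD Et (sf.phi M) (p, t0) = dd (0, 1) (sf.phi M) (p, t0)"
    by (simp add: LD_def dd_Et[OF sm z] crit)
  ultimately have dt: "dd (0, 1) (sf.phi M) (p, t0) \<le> 0" by simp
  have time: "((\<lambda>t. F (p, t)) has_real_derivative dd (0, 1) F (p, t0)) (at t0)"
    if F: "smooth_on D F" for F :: "(real^3) \<times> real \<Rightarrow> real"
  proof -
    have "((\<lambda>t. (p, t)) has_derivative (\<lambda>h. (0, h))) (at t0)"
      by (auto intro!: derivative_eq_intros)
    then have D: "((\<lambda>t. F (p, t)) has_derivative (\<lambda>h. dd (0, h) F (p, t0))) (at t0)"
      by (rule has_derivative_compose) (rule smooth_on_has_derivative[OF open_D F z])
    have eq: "(\<lambda>h. dd (0, h) F (p, t0)) = (\<lambda>h. dd (0, 1) F (p, t0) * h)"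
    proof
      fix h show "dd (0, h) F (p, t0) = dd (0, 1) F (p, t0) * h"
        using linear_cmul[OF dd_linear[OF open_D F z], of h "(0, 1)"] by (simp add: mult.commute)
    qed
    show ?thesis using D unfolding eq has_field_derivative_def .
  qed
  \<comment> \<open>\<open>psi\<close> is \<open>u\<close> times pinching - M + eps (t0 - t). By
    \<open>past\<close> it is nonpositive just before \<open>t0\<close>, it vanishes at
    \<open>t0\<close>, and yet its derivative there is negative.\<close>
  define psi where "psi t = sf.phi M (p, t) + eps * (t0 - t) * sf.u (p, t)" for t
  have "(psi has_real_derivative dd (0, 1) (sf.phi M) (p, t0) - eps * sf.u (p, t0)) (at t0)"
    unfolding psi_def by (auto intro!: derivative_eq_intros time[OF sm] time[OF sf.smooth_u])
  moreover have "eps * sf.u (p, t0) > 0" using eps fv(1)[OF z] by simp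
  ultimately obtain d where d: "d > 0" "\<And>h. 0 < h \<Longrightarrow> h < d \<Longrightarrow> psi t0 < psi (t0 - h)"
    using DERIV_neg_dec_left[of psi _ t0] dt by force
  define r where "r = min d (min de (t0 - a)) / 2"
  have r: "0 < r" "r < d" "r < de" "r < t0 - a" using d(1) de t0 by (auto simp: r_def)
  define t where "t = t0 - r"
  have t: "t0 - de < t" "t < t0" "t \<in> {a<..<b}" using r t0 by (auto simp: t_def)
  have "pinching t p - M \<le> - (eps * (t0 - t))" using past[OF t(1,2)] by (simp add: M_def algebra_simps)
  then have "sf.u (p, t) * (pinching t p - M) \<le> sf.u (p, t) * (- (eps * (t0 - t)))"
    using fv(1)[OF S2_D[OF p t(3)]] by (intro mult_left_mono) auto
  then have "psi t \<le> 0"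
    unfolding psi_def using fv(2)[OF S2_D[OF p t(3)], of M] p by (simp add: sgn_id algebra_simps)
  moreover have "psi t0 = 0" by (simp add: psi_def phi0)
  ultimately show False using d(2)[OF r(1,2)] by (simp add: t_def)
qed

text \<open>A maximum of pinching minus \<open>eps * t\<close> over the compact slab between the two
  times cannot be attained after the initial one.\<close>

lemma pinching_le_SUP:
  assumes "a < s" "s \<le> t" "t < b" "p \<in> S2"
  shows "pinching t p \<le> (SUP q\<in>S2. pinching s q)"
proof -
  have comp: "compact (S2 \<times> {s..t})" by (simp add: S2_def compact_Times)
  have sub: "S2 \<times> {s..t} \<subseteq> S2 \<times> {a<..<b}" using assms by auto
  have "compact ((\<lambda>z. pinching (snd z) (fst z)) ` (S2 \<times> {s..t}))"
    by (intro compact_continuous_image continuous_on_subset[OF continuous_pinching sub] comp)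
  then have "bdd_above ((\<lambda>z. pinching (snd z) (fst z)) ` (S2 \<times> {s..t}))"
    by (intro bounded_imp_bdd_above compact_imp_bounded)
  \<comment> \<open>A real supremum is an upper bound only for sets that are bounded above.\<close>
  then have bdd: "bdd_above (pinching s ` S2)"
    by (rule bdd_above_mono) (use assms in force)
  have "pinching t p \<le> (SUP q\<in>S2. pinching s q) + eps * (t - s)" if eps: "eps > 0" for eps
  proof -
    have "continuous_on (S2 \<times> {s..t}) (\<lambda>z. pinching (snd z) (fst z) - eps * snd z)"
      by (intro continuous_intros continuous_on_subset[OF continuous_pinching sub])
    moreover have "S2 \<times> {s..t} \<noteq> {}" using assms by auto
    ultimately obtain z where z: "z \<in> S2 \<times> {s..t}"
      "\<forall>y\<in>S2 \<times> {s..t}. pinching (snd y) (fst y) - eps * snd y \<le> pinching (snd z) (fst z) - eps * snd z"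
      using continuous_attains_sup[OF comp] by blast
    then obtain q r where qr: "q \<in> S2" "s \<le> r" "r \<le> t"
      and max: "\<And>q' r'. q' \<in> S2 \<Longrightarrow> s \<le> r' \<Longrightarrow> r' \<le> t \<Longrightarrow> pinching r' q' - eps * r' \<le> pinching r q - eps * r"
      by force
    have "r = s"
    proof (rule ccontr)
      assume "r \<noteq> s"
      then have rs: "r > s" using qr by simp
      show False
      proof (rule pinching_maximum_no_growth[of r q eps "r - s"])
        show "r \<in> {a<..<b}" using qr assms by auto
        show "pinching r q' \<le> pinching r q" if "q' \<in> S2" for q' using max[OF that, of r] qr by simp
        show "pinching t' q - eps * t' \<le> pinching r q - eps * r" if "r - (r - s) < t'" "t' < r" for t'
          using max[OF qr(1), of t'] that qr by simp
      qed (use qr eps rs in auto)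
    qed
    then have "pinching t p - eps * t \<le> pinching s q - eps * s"
      using max[OF assms(4), of t] assms by simp
    moreover have "pinching s q \<le> (SUP q\<in>S2. pinching s q)" by (rule cSUP_upper[OF qr(1) bdd])
    ultimately show ?thesis by (simp add: algebra_simps)
  qed
  note * = this
  show ?thesis
  proof (rule field_le_epsilon)
    fix e :: real assume e: "e > 0"
    \<comment> \<open>The summand 1 keeps the denominator positive if the two times
      coincide.\<close>
    have "e / (t - s + 1) * (t - s) \<le> e" using e assms(2) by (simp add: field_simps)
    moreover have "e / (t - s + 1) > 0" using e assms(2) by simp
    ultimately show "pinching t p \<le> (SUP q\<in>S2. pinching s q) + e"
      using *[of "e / (t - s + 1)"] by linarith
  qed
qed

end

theorem theorem10p2:
  fixes X :: "real^3 \<Rightarrow> real \<Rightarrow> real^3" and a b :: real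
  assumes "a < b"
    and "\<exists>U. open U \<and> S2 \<times> {a<..<b} \<subseteq> U \<and> smooth_on U (\<lambda>z. X (fst z) (snd z))"
    and "\<forall>t\<in>{a<..<b}. embedded_surface X t \<and> strictly_convex X t"
    and "\<forall>t\<in>{a<..<b}. \<forall>p\<in>S2. ((\<lambda>s. X p s) has_vector_derivative
           ((mean_curv X t p)\<^sup>2 / (gauss_curv X t p)\<^sup>2) *\<^sub>R outer_normal X t p) (at t)"
  shows "\<forall>s t. a < s \<longrightarrow> s \<le> t \<longrightarrow> t < b \<longrightarrow>
    (SUP p\<in>S2. (kappa1 X t p - kappa2 X t p)\<^sup>2 /
        (2 * (kappa1 X t p + kappa2 X t p) * kappa1 X t p * kappa2 X t p))
    \<le> (SUP p\<in>S2. (kappa1 X s p - kappa2 X s p)\<^sup>2 /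
        (2 * (kappa1 X s p + kappa2 X s p) * kappa1 X s p * kappa2 X s p))"
proof (intro allI impI)
  fix s t assume st: "a < s" "s \<le> t" "t < b"
  obtain U where "open U" "S2 \<times> {a<..<b} \<subseteq> U" "smooth_on U (\<lambda>z. X (fst z) (snd z))"
    using assms(2) by blast
  then interpret inverse_curvature_flow X a b U
    using assms(3,4) by unfold_locales auto
  have "S2 \<noteq> {}" by (simp add: S2_def)
  then have "(SUP p\<in>S2. pinching t p) \<le> (SUP p\<in>S2. pinching s p)"
    by (rule cSUP_least) (rule pinching_le_SUP[OF st])
  then show "(SUP p\<in>S2. (kappa1 X t p - kappa2 X t p)\<^sup>2 /
        (2 * (kappa1 X t p + kappa2 X t p) * kappa1 X t p * kappa2 X t p))
    \<le> (SUP p\<in>S2. (kappa1 X s p - kappa2 X s p)\<^sup>2 /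
        (2 * (kappa1 X s p + kappa2 X s p) * kappa1 X s p * kappa2 X s p))"
    unfolding pinching_def .
qed

end
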